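(* Let $(\Omega,\Sigma,\mu)$ be a complete $\sigma$-finite measure space and let $p:\Omega\to[1,+\infty]$ be a measurable function. The following are equivalent: a) $L^{p(\cdot)}(\Omega)$ contains an isometric copy of $\ell_1$. b) $L^{p(\cdot)}(\Omega)$ contains an asymptotically isometric copy of $\ell_1$.
   Context: Variable Lebesgue space: for a measurable $p:\Omega\to[1,+\infty]$ put $\Omega_f=\{t: p(t)<+\infty\}$ and, for measurable $g:\Omega\to\mathbb{R}$ (functions equal a.e. are identified), define the modular $\rho(g)=\int_{\Omega_f}|g(t)|^{p(t)}\,d\mu+\operatorname{ess\,sup}_{t\in p^{-1}(\{+\infty\})}|g(t)|$ (the last term is $0$ if $p^{-1}(\{+\infty\})$ is null). $L^{p(\cdot)}(\Omega)$ is the space of those $g$ with $\rho(g/\lambda)<\infty$ for some $\lambda>0$, with the Luxemburg norm $\|g\|=\inf\{\alpha>0:\rho(g/\alpha)\le 1\}$; it is a real Banach space. $X$ contains an isometric copy of $\ell_1$ if there is a linear isometric embedding $\ell_1\to X$. A Banach space $X$ contains an asymptotically isometric copy of $\ell_1$ if there exist a sequence $(z_n)\subset X$ and a sequence $(\epsilon_n)\subset(0,1)$ with $\lim_n\epsilon_n=0$ such that $\sum_{n=1}^\infty(1-\epsilon_n)|t_n|\le\left\|\sum_{n=1}^\infty t_nz_n\right\|\le\sum_{n=1}^\infty|t_n|$ for all $(t_n)\in\ell_1$. *)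

theory Defs
  imports "HOL-Probability.Essential_Supremum"
begin

section \<open>Copies of normed spaces inside normed spaces\<close>

text \<open>The spaces below depend on a measure and an exponent, so they cannot be instances of the
  class \<^class>\<open>real_normed_vector\<close>; they are given by their operations on an explicit carrier.\<close>

record 'v normed_space_ops =
  vecs :: "'v set"
  vzero :: 'v
  vadd :: "'v \<Rightarrow> 'v \<Rightarrow> 'v"
  vscale :: "real \<Rightarrow> 'v \<Rightarrow> 'v"
  vnorm :: "'v \<Rightarrow> real"

definition linear_isometric_embedding ::
    "'u normed_space_ops \<Rightarrow> 'v normed_space_ops \<Rightarrow> ('u \<Rightarrow> 'v) \<Rightarrow> bool" where
  "linear_isometric_embedding Y X T \<longleftrightarrow>
     (\<forall>a\<in>vecs Y. T a \<in> vecs X) \<and>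
     (\<forall>a\<in>vecs Y. \<forall>b\<in>vecs Y. T (vadd Y a b) = vadd X (T a) (T b)) \<and>
     (\<forall>c. \<forall>a\<in>vecs Y. T (vscale Y c a) = vscale X c (T a)) \<and>
     (\<forall>a\<in>vecs Y. vnorm X (T a) = vnorm Y a)"

fun vsum_lessThan :: "'v normed_space_ops \<Rightarrow> (nat \<Rightarrow> 'v) \<Rightarrow> nat \<Rightarrow> 'v" where
  "vsum_lessThan X x 0 = vzero X"
| "vsum_lessThan X x (Suc N) = vadd X (vsum_lessThan X x N) (x N)"

definition vsums :: "'v normed_space_ops \<Rightarrow> (nat \<Rightarrow> 'v) \<Rightarrow> 'v \<Rightarrow> bool" where
  "vsums X x s \<longleftrightarrow> s \<in> vecs X \<and>
     (\<lambda>N. vnorm X (vadd X (vsum_lessThan X x N) (vscale X (-1) s))) \<longlonglongrightarrow> 0"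

definition ell1 :: "(nat \<Rightarrow> real) normed_space_ops" where
  "ell1 = \<lparr> vecs = {t. summable (\<lambda>n. \<bar>t n\<bar>)},
            vzero = (\<lambda>n. 0),
            vadd = (\<lambda>s t n. s n + t n),
            vscale = (\<lambda>c t n. c * t n),
            vnorm = (\<lambda>t. \<Sum>n. \<bar>t n\<bar>) \<rparr>"

definition contains_isometric_copy_ell1 :: "'v normed_space_ops \<Rightarrow> bool" where
  "contains_isometric_copy_ell1 X \<longleftrightarrow> (\<exists>T. linear_isometric_embedding ell1 X T)"

text \<open>The norm of the infinite sum of the \<open>t n z n\<close> is the norm of the norm limit \<open>s\<close> of its partial
  sums; the existence of this limit is part of the condition (it is automatic in a Banach space).
  Sequences are indexed from 0.\<close>

definition contains_asymptotically_isometric_copy_ell1 :: "'v normed_space_ops \<Rightarrow> bool" where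
  "contains_asymptotically_isometric_copy_ell1 X \<longleftrightarrow>
     (\<exists>(z :: nat \<Rightarrow> 'v) (\<epsilon> :: nat \<Rightarrow> real).
        (\<forall>n. z n \<in> vecs X) \<and> (\<forall>n. 0 < \<epsilon> n \<and> \<epsilon> n < 1) \<and> \<epsilon> \<longlonglongrightarrow> 0 \<and>
        (\<forall>t\<in>vecs ell1. \<exists>s. vsums X (\<lambda>n. vscale X (t n) (z n)) s \<and>
            (\<Sum>n. (1 - \<epsilon> n) * \<bar>t n\<bar>) \<le> vnorm X s \<and> vnorm X s \<le> (\<Sum>n. \<bar>t n\<bar>)))"


section \<open>Variable Lebesgue spaces\<close>

text \<open>The essential supremum is taken in \<^typ>\<open>ennreal\<close>, so that it is \<open>0\<close> when the set where
  \<open>p = \<infinity>\<close> is null (see \<open>modular_null_top\<close> below).\<close>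

definition modular :: "'a measure \<Rightarrow> ('a \<Rightarrow> ennreal) \<Rightarrow> ('a \<Rightarrow> real) \<Rightarrow> ennreal" where
  "modular M p g =
     (\<integral>\<^sup>+ x \<in> {x \<in> space M. p x < \<infinity>}. ennreal (\<bar>g x\<bar> powr enn2real (p x)) \<partial>M)
     + esssup (restrict_space M (p -` {\<infinity>})) (\<lambda>x. ennreal \<bar>g x\<bar>)"

definition var_Lebesgue_fun :: "'a measure \<Rightarrow> ('a \<Rightarrow> ennreal) \<Rightarrow> ('a \<Rightarrow> real) set" where
  "var_Lebesgue_fun M p =
     {g \<in> borel_measurable M. \<exists>l>0. modular M p (\<lambda>x. g x / l) < \<infinity>}"

definition luxemburg :: "'a measure \<Rightarrow> ('a \<Rightarrow> ennreal) \<Rightarrow> ('a \<Rightarrow> real) \<Rightarrow> real" where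
  "luxemburg M p g = Inf {\<alpha>. \<alpha> > 0 \<and> modular M p (\<lambda>x. g x / \<alpha>) \<le> 1}"

definition AE_class :: "'a measure \<Rightarrow> ('a \<Rightarrow> real) \<Rightarrow> ('a \<Rightarrow> real) set" where
  "AE_class M f = {g \<in> borel_measurable M. AE x in M. g x = f x}"

text \<open>The quotient by equality almost everywhere. The operations on classes do not depend on the
  representatives: see \<open>AE_class_add\<close>, \<open>AE_class_scale\<close> and \<open>AE_class_norm\<close> below.\<close>

definition var_Lebesgue :: "'a measure \<Rightarrow> ('a \<Rightarrow> ennreal) \<Rightarrow> ('a \<Rightarrow> real) set normed_space_ops" where
  "var_Lebesgue M p =
     \<lparr> vecs = AE_class M ` var_Lebesgue_fun M p,
       vzero = AE_class M (\<lambda>x. 0),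
       vadd = (\<lambda>A B. \<Union>f\<in>A. \<Union>g\<in>B. AE_class M (\<lambda>x. f x + g x)),
       vscale = (\<lambda>c A. \<Union>f\<in>A. AE_class M (\<lambda>x. c * f x)),
       vnorm = (\<lambda>A. the_elem (luxemburg M p ` A)) \<rparr>"

lemma AE_class_self: "f \<in> borel_measurable M \<Longrightarrow> f \<in> AE_class M f"
  by (simp add: AE_class_def)

lemma AE_class_cong:
  assumes "AE x in M. f x = g x"
  shows "AE_class M f = AE_class M g"
proof -
  have "(AE x in M. h x = f x) \<longleftrightarrow> (AE x in M. h x = g x)" for h
    by (rule eventually_subst, rule eventually_mono[OF assms]) simp
  then show ?thesis by (simp add: AE_class_def)
qed

lemma AE_class_add:
  assumes "f \<in> borel_measurable M" "g \<in> borel_measurable M"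
  shows "vadd (var_Lebesgue M p) (AE_class M f) (AE_class M g) = AE_class M (\<lambda>x. f x + g x)"
proof -
  have "AE_class M (\<lambda>x. f' x + g' x) = AE_class M (\<lambda>x. f x + g x)"
    if "f' \<in> AE_class M f" "g' \<in> AE_class M g" for f' g'
    using that by (intro AE_class_cong) (auto simp: AE_class_def)
  then have "(\<Union>f'\<in>AE_class M f. \<Union>g'\<in>AE_class M g. AE_class M (\<lambda>x. f' x + g' x))
      = (\<Union>f'\<in>AE_class M f. \<Union>g'\<in>AE_class M g. AE_class M (\<lambda>x. f x + g x))"
    by simp
  then show ?thesis
    using AE_class_self[OF assms(1)] AE_class_self[OF assms(2)] by (auto simp: var_Lebesgue_def)
qed

lemma AE_class_scale:
  assumes "f \<in> borel_measurable M"
  shows "vscale (var_Lebesgue M p) c (AE_class M f) = AE_class M (\<lambda>x. c * f x)"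
proof -
  have "AE_class M (\<lambda>x. c * f' x) = AE_class M (\<lambda>x. c * f x)" if "f' \<in> AE_class M f" for f'
    using that by (intro AE_class_cong) (auto simp: AE_class_def)
  then have "(\<Union>f'\<in>AE_class M f. AE_class M (\<lambda>x. c * f' x))
      = (\<Union>f'\<in>AE_class M f. AE_class M (\<lambda>x. c * f x))"
    by simp
  then show ?thesis
    using AE_class_self[OF assms] by (auto simp: var_Lebesgue_def)
qed

lemma modular_cong:
  assumes p: "p \<in> borel_measurable M" and g: "g \<in> borel_measurable M"
    and h: "h \<in> borel_measurable M" and eq: "AE x in M. g x = h x"
  shows "modular M p g = modular M p h"
proof -
  have P: "p -` {\<infinity>} \<inter> space M \<in> sets M"
    using p by measurable
  have "(\<integral>\<^sup>+ x \<in> {x \<in> space M. p x < \<infinity>}. ennreal (\<bar>g x\<bar> powr enn2real (p x)) \<partial>M)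
      = (\<integral>\<^sup>+ x \<in> {x \<in> space M. p x < \<infinity>}. ennreal (\<bar>h x\<bar> powr enn2real (p x)) \<partial>M)"
    using eq by (intro nn_integral_cong_AE) auto
  moreover have "AE x in restrict_space M (p -` {\<infinity>}). ennreal \<bar>g x\<bar> = ennreal \<bar>h x\<bar>"
    using eq by (subst AE_restrict_space_iff) (use P in \<open>auto simp: Int_commute\<close>)
  then have "esssup (restrict_space M (p -` {\<infinity>})) (\<lambda>x. ennreal \<bar>g x\<bar>)
      = esssup (restrict_space M (p -` {\<infinity>})) (\<lambda>x. ennreal \<bar>h x\<bar>)"
    using g h unfolding esssup_def
    by (intro if_cong Limsup_eq) (auto simp: measurable_restrict_space1)
  ultimately show ?thesis by (simp add: modular_def)
qed

lemma modular_null_top: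
  assumes p: "p \<in> borel_measurable M" and g: "g \<in> borel_measurable M"
    and null: "AE x in M. p x < \<infinity>"
  shows "modular M p g =
    (\<integral>\<^sup>+ x \<in> {x \<in> space M. p x < \<infinity>}. ennreal (\<bar>g x\<bar> powr enn2real (p x)) \<partial>M)"
proof -
  have P: "p -` {\<infinity>} \<inter> space M \<in> sets M"
    using p by measurable
  have "AE x in restrict_space M (p -` {\<infinity>}). ennreal \<bar>g x\<bar> \<le> 0"
    using null by (subst AE_restrict_space_iff) (use P in \<open>auto simp: Int_commute\<close>)
  then have "esssup (restrict_space M (p -` {\<infinity>})) (\<lambda>x. ennreal \<bar>g x\<bar>) \<le> 0"
    using g by (intro esssup_I) (auto intro!: measurable_restrict_space1)
  then show ?thesis by (simp add: modular_def)
qed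

lemma AE_class_norm:
  assumes p: "p \<in> borel_measurable M" and f: "f \<in> borel_measurable M"
  shows "vnorm (var_Lebesgue M p) (AE_class M f) = luxemburg M p f"
proof -
  have "luxemburg M p g = luxemburg M p f" if g: "g \<in> AE_class M f" for g
  proof -
    have "modular M p (\<lambda>x. g x / \<alpha>) = modular M p (\<lambda>x. f x / \<alpha>)" for \<alpha>
      using g f by (intro modular_cong p) (auto simp: AE_class_def)
    then show ?thesis by (simp add: luxemburg_def)
  qed
  then have "luxemburg M p ` AE_class M f = (\<lambda>_. luxemburg M p f) ` AE_class M f"
    by (rule image_cong[OF refl])
  also have "\<dots> = {luxemburg M p f}"
    by (rule image_constant[OF AE_class_self[OF f]])
  finally show ?thesis by (simp add: var_Lebesgue_def)
qed

end

theory Submission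
  imports Defs
begin

text \<open>
  Applying an isometric embedding of \<open>\<ell>\<^sub>1\<close> to the unit vectors gives an asymptotically isometric copy,
  so only the converse has content. Let \<open>\<Omega>\<^sub>1\<close> and \<open>\<Omega>\<^sub>\<infinity>\<close> be the sets where the exponent \<open>p\<close> is \<open>1\<close>
  and \<open>\<infinity>\<close>. There are three situations in which \<open>\<ell>\<^sub>1\<close> embeds isometrically.

  \<^item> \<open>\<Omega>\<^sub>1\<close> contains infinitely many disjoint non-null sets: the normalized indicators of
    subsets of finite measure span \<open>\<ell>\<^sub>1\<close> (\<open>isometric_copy_ell1_of_exponent_1\<close>).
  \<^item> \<open>\<Omega>\<^sub>\<infinity>\<close> contains infinitely many disjoint non-null sets: their indicators span a copy of the
    supremum norm, and \<open>\<ell>\<^sub>1\<close> embeds there through the functionals \<open>t \<mapsto> \<Sum>\<^sub>m \<plusminus>t\<^sub>m\<close>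
    (\<open>isometric_copy_ell1_of_top_exponent\<close>).
  \<^item> \<open>p\<close> is essentially unbounded on the set where it is finite: there are disjoint functions
    \<open>f\<^sub>n\<close> whose modulars have sum \<open>1\<close> although, for every \<open>\<lambda> > 1\<close>, the modular of \<open>\<lambda> f\<^sub>n\<close> exceeds
    \<open>1\<close> for large \<open>n\<close>, so the supremum norm appears again
    (\<open>isometric_copy_ell1_of_unbounded_exponent\<close>).

  It remains to refute an asymptotically isometric copy \<open>(z\<^sub>n)\<close> when none of these holds
  (\<open>no_asymptotically_isometric_copy\<close>). Then \<open>\<Omega>\<^sub>1 \<union> \<Omega>\<^sub>\<infinity>\<close> is a finite union of atoms up to a null set,
  so some \<open>y = (z\<^sub>i - z\<^sub>j) / 4\<close> is almost \<open>0\<close> there. The lower \<open>\<ell>\<^sub>1\<close> estimate says that, for small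
  \<open>\<tau> > 0\<close> and then large \<open>n\<close>, both \<open>z\<^sub>n + \<tau> y\<close> and \<open>z\<^sub>n - \<tau> y\<close> have norm at least \<open>1 + \<tau> / 8\<close>. On the
  other hand \<open>(\<bar>b + a\<bar>\<^sup>q + \<bar>b - a\<bar>\<^sup>q) / 2\<close> exceeds \<open>\<bar>b\<bar>\<^sup>q\<close> only to an order higher than the first in \<open>a\<close>
  when \<open>q > 1\<close> (\<open>abs_powr_smooth_le\<close>). After integration this shows that the modular, averaged over
  the two signs, grows by \<open>o(\<tau>)\<close> plus a small multiple of \<open>\<tau>\<close> from \<open>\<Omega>\<^sub>1 \<union> \<Omega>\<^sub>\<infinity>\<close>, uniformly in \<open>n\<close>
  (\<open>modular_smooth_le\<close>), which is a contradiction. Overlaps between the supports of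
  \<open>z\<^sub>n\<close> and \<open>y\<close> contribute to the first order with opposite signs, so they cancel in the average.
\<close>

section \<open>Inequalities for real powers\<close>

lemma powr_le_self: "u powr q \<le> u" if "0 \<le> u" "u \<le> 1" "1 \<le> q" for u q :: real
  using that powr_mono'[of 1 q u] by (cases "u = 0") auto

lemma abs_powr_convex:
  fixes q u v a b :: real
  assumes q: "1 \<le> q" and u: "0 \<le> u" and v: "0 \<le> v" and uv: "u + v = 1"
  shows "\<bar>u * a + v * b\<bar> powr q \<le> u * \<bar>a\<bar> powr q + v * \<bar>b\<bar> powr q"
proof -
  have "\<bar>u * a + v * b\<bar> \<le> u * \<bar>a\<bar> + v * \<bar>b\<bar>"
    using abs_triangle_ineq[of "u * a" "v * b"] u v by (simp add: abs_mult)
  then have "\<bar>u * a + v * b\<bar> powr q \<le> (u * \<bar>a\<bar> + v * \<bar>b\<bar>) powr q"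
    using q by (intro powr_mono2) auto
  also have "\<dots> \<le> u * \<bar>a\<bar> powr q + v * \<bar>b\<bar> powr q"
  proof (cases "a = 0 \<or> b = 0")
    case True
    have "u powr q \<le> u" "v powr q \<le> v"
      using powr_le_self u v uv q by auto
    then have "u powr q * \<bar>a\<bar> powr q \<le> u * \<bar>a\<bar> powr q" "v powr q * \<bar>b\<bar> powr q \<le> v * \<bar>b\<bar> powr q"
      by (auto intro: mult_right_mono)
    then show ?thesis using True u v by (auto simp: powr_mult)
  next
    case False
    moreover have "1 - v = u" using uv by simp
    ultimately show ?thesis
      using convex_onD[OF powr_convex[OF q], of v "\<bar>a\<bar>" "\<bar>b\<bar>"] u v by simp
  qed
  finally show ?thesis .
qed

text \<open>The hyperbolic cosine differs from \<open>1\<close> by a term of second order at \<open>0\<close>. Only \<open>e\<^sup>w \<le> 1 + w e\<^sup>w\<close> enters, first for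
  \<open>w = z\<close> and \<open>w = -z\<close>, then for \<open>w = 2 z\<close>.\<close>

lemma exp_add_exp_minus_le:
  fixes z :: real
  assumes "0 \<le> z"
  shows "exp z + exp (- z) \<le> 2 + 2 * z\<^sup>2 * exp z"
proof -
  have exp_le: "exp w \<le> 1 + w * exp w" for w :: real
  proof -
    have "(1 - w) * exp w \<le> exp (- w) * exp w"
      using exp_ge_add_one_self[of "- w"] by (intro mult_right_mono) auto
    then show ?thesis by (simp add: algebra_simps flip: exp_add)
  qed
  have "exp z + exp (- z) - 2 \<le> z * (exp z - exp (- z))"
    using exp_le[of z] exp_le[of "- z"] by (simp add: algebra_simps)
  also have "\<dots> \<le> z * (exp (- z) * (2 * z * exp (2 * z)))"
  proof -
    have "exp (- z) * exp (2 * z) \<le> exp (- z) * (1 + 2 * z * exp (2 * z))"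
      using exp_le[of "2 * z"] by (intro mult_left_mono) auto
    then have "exp z - exp (- z) \<le> exp (- z) * (2 * z * exp (2 * z))"
      by (simp add: algebra_simps flip: exp_add)
    then show ?thesis using assms by (rule mult_left_mono)
  qed
  also have "\<dots> = 2 * z\<^sup>2 * exp z"
    by (simp add: power2_eq_square algebra_simps flip: exp_add)
  finally show ?thesis by simp
qed

text \<open>From \<open>(1 + r)\<^sup>q \<le> e\<^sup>q\<^sup>r\<close> for both signs of \<open>r\<close>. The upper bound \<open>P\<close> of the exponents makes
  the constant independent of \<open>q\<close>, which is where essential boundedness of the exponent enters.\<close>

lemma powr_one_plus_one_minus_le:
  fixes q P s :: real
  assumes q: "1 \<le> q" "q \<le> P" and s: "\<bar>s\<bar> \<le> 1"
  shows "(1 + s) powr q + (1 - s) powr q \<le> 2 + 2 * (P\<^sup>2 * exp P) * s\<^sup>2"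
proof -
  have le: "(1 + r) powr q \<le> exp (q * r)" if "\<bar>r\<bar> \<le> 1" for r
  proof -
    have "(1 + r) powr q \<le> exp r powr q"
      using that q exp_ge_add_one_self[of r] by (intro powr_mono2) auto
    then show ?thesis by (simp add: powr_def)
  qed
  have "(1 + s) powr q + (1 - s) powr q \<le> exp (q * s) + exp (- (q * s))"
    using le[of s] le[of "- s"] s by simp
  also have "\<dots> = exp (q * \<bar>s\<bar>) + exp (- (q * \<bar>s\<bar>))"
    by (cases "s \<ge> 0") auto
  also have "\<dots> \<le> 2 + 2 * (q * \<bar>s\<bar>)\<^sup>2 * exp (q * \<bar>s\<bar>)"
    using q by (intro exp_add_exp_minus_le) auto
  also have "\<dots> \<le> 2 + 2 * (P * \<bar>s\<bar>)\<^sup>2 * exp P"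
  proof -
    have "(q * \<bar>s\<bar>)\<^sup>2 \<le> (P * \<bar>s\<bar>)\<^sup>2"
      using q by (intro power_mono mult_right_mono) auto
    moreover have "q * \<bar>s\<bar> \<le> P * 1"
      using q s by (intro mult_mono) auto
    then have "exp (q * \<bar>s\<bar>) \<le> exp P" by simp
    ultimately show ?thesis by (auto intro!: mult_mono)
  qed
  finally show ?thesis by (simp add: power_mult_distrib algebra_simps)
qed

text \<open>The average over the two signs cancels the first-order term of a perturbation. With \<open>a = \<tau> y\<close>,
  the remainder is at most \<open>C \<bar>b\<bar>\<^sup>q (a / b)\<^sup>2\<close> when \<open>\<bar>a\<bar> \<le> \<bar>b\<bar>\<close>, and \<open>C \<bar>a\<bar>\<^sup>q\<close> otherwise. For \<open>q \<le> 2\<close> the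
  former is at most \<open>C \<bar>a\<bar>\<^sup>q\<close>, which does not involve \<open>b\<close>: this is essential, since no power of \<open>\<tau>\<close>
  higher than the first is available uniformly as \<open>q\<close> approaches \<open>1\<close>. For \<open>q > 2\<close> a term
  \<open>\<tau>\<^sup>2 \<bar>b\<bar>\<^sup>q\<close> appears, which is small uniformly in \<open>q\<close>.\<close>

lemma abs_powr_smooth_le:
  fixes b y q P \<tau> :: real
  assumes q: "1 \<le> q" "q \<le> P" and \<tau>: "0 < \<tau>" "\<tau> \<le> 1"
  shows "\<bar>b + \<tau> * y\<bar> powr q + \<bar>b - \<tau> * y\<bar> powr q
    \<le> 2 * (\<bar>b\<bar> powr q + (1 + P\<^sup>2 * exp P) * (\<tau> powr min q 2 * \<bar>y\<bar> powr q + \<tau>\<^sup>2 * \<bar>b\<bar> powr q))"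
proof -
  define K where "K = P\<^sup>2 * exp P"
  have K: "0 \<le> K" by (simp add: K_def)
  have homogeneous: "\<bar>c + a\<bar> powr q + \<bar>c - a\<bar> powr q \<le> 2 * (\<bar>c\<bar> powr q + K * (\<bar>c\<bar> powr q * (a / c)\<^sup>2))"
    if "\<bar>a\<bar> \<le> \<bar>c\<bar>" "c \<noteq> 0" for a c :: real
  proof -
    have s: "\<bar>a / c\<bar> \<le> 1" using that by (simp add: divide_simps)
    have "c + a = c * (1 + a / c)" "c - a = c * (1 - a / c)"
      using that by (auto simp: field_simps)
    then have "\<bar>c + a\<bar> powr q + \<bar>c - a\<bar> powr q
        = \<bar>c\<bar> powr q * ((1 + a / c) powr q + (1 - a / c) powr q)"
      using s by (simp only: abs_mult) (auto simp: powr_mult algebra_simps abs_if)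
    also have "\<dots> \<le> \<bar>c\<bar> powr q * (2 + 2 * K * (a / c)\<^sup>2)"
      using powr_one_plus_one_minus_le[OF q s] unfolding K_def by (intro mult_left_mono) auto
    finally show ?thesis by (simp add: algebra_simps)
  qed
  define m where "m = min q 2"
  have m: "1 \<le> m" "m \<le> q" "m \<le> 2" using q by (auto simp: m_def)
  have \<tau>q: "\<tau> powr q \<le> \<tau> powr m" using \<tau> m by (intro powr_mono') auto
  show ?thesis
  proof (cases "\<tau> * \<bar>y\<bar> < \<bar>b\<bar>")
    case True
    have "0 \<le> \<tau> * \<bar>y\<bar>" using \<tau> by simp
    with True have b: "b \<noteq> 0" by auto
    have "\<bar>b\<bar> powr q * (\<tau> * y / b)\<^sup>2 \<le> \<tau> powr m * \<bar>y\<bar> powr q + \<tau>\<^sup>2 * \<bar>b\<bar> powr q"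
    proof (cases "y = 0")
      case False
      show ?thesis
      proof (cases "q \<le> 2")
        case True
        have "(\<tau> * y / b)\<^sup>2 = (\<tau> * \<bar>y\<bar> / \<bar>b\<bar>) powr 2"
          using \<tau> b False by (simp add: power_divide power_mult_distrib powr_numeral)
        also have "\<dots> \<le> (\<tau> * \<bar>y\<bar> / \<bar>b\<bar>) powr q"
          using True \<open>\<tau> * \<bar>y\<bar> < \<bar>b\<bar>\<close> b \<tau> by (intro powr_mono') auto
        finally have "\<bar>b\<bar> powr q * (\<tau> * y / b)\<^sup>2 \<le> \<bar>b\<bar> powr q * (\<tau> * \<bar>y\<bar> / \<bar>b\<bar>) powr q"
          by (intro mult_left_mono) auto
        also have "\<dots> = \<tau> powr m * \<bar>y\<bar> powr q"
        proof -
          have "(\<tau> * \<bar>y\<bar> / \<bar>b\<bar>) powr q = \<tau> powr q * \<bar>y\<bar> powr q / \<bar>b\<bar> powr q"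
            using \<tau> by (simp only: powr_divide powr_mult)
          moreover have "m = q" using True by (simp add: m_def)
          ultimately show ?thesis using b by simp
        qed
        finally show ?thesis by (simp add: add_increasing2)
      next
        case q2: False
        then have m2: "\<tau> powr m = \<tau>\<^sup>2" using \<tau> by (simp add: m_def powr_numeral)
        have "\<bar>b\<bar> powr q * (y / b)\<^sup>2 \<le> \<bar>y\<bar> powr q + \<bar>b\<bar> powr q"
        proof (cases "\<bar>y\<bar> \<le> \<bar>b\<bar>")
          case True
          then have "\<bar>y / b\<bar> \<le> 1" using b by (simp add: divide_simps)
          then have "(y / b)\<^sup>2 \<le> 1" using abs_square_le_1 by blast
          then have "\<bar>b\<bar> powr q * (y / b)\<^sup>2 \<le> \<bar>b\<bar> powr q * 1"
            by (intro mult_left_mono) auto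
          then show ?thesis by (simp add: add_increasing)
        next
          case large: False
          have "(y / b)\<^sup>2 = (\<bar>y\<bar> / \<bar>b\<bar>) powr 2"
            using b False by (simp add: power_divide powr_numeral)
          also have "\<dots> \<le> (\<bar>y\<bar> / \<bar>b\<bar>) powr q"
            using q2 large b by (intro powr_mono) auto
          finally have "\<bar>b\<bar> powr q * (y / b)\<^sup>2 \<le> \<bar>b\<bar> powr q * (\<bar>y\<bar> / \<bar>b\<bar>) powr q"
            by (intro mult_left_mono) auto
          also have "\<dots> = \<bar>y\<bar> powr q" using b by (simp add: powr_divide)
          finally show ?thesis by (simp add: add_increasing2)
        qed
        then have "\<tau>\<^sup>2 * (\<bar>b\<bar> powr q * (y / b)\<^sup>2) \<le> \<tau>\<^sup>2 * (\<bar>y\<bar> powr q + \<bar>b\<bar> powr q)"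
          by (intro mult_left_mono) auto
        then show ?thesis by (simp add: m2 power_mult_distrib power_divide algebra_simps)
      qed
    qed auto
    then have "K * (\<bar>b\<bar> powr q * (\<tau> * y / b)\<^sup>2) \<le> (1 + K) * (\<tau> powr m * \<bar>y\<bar> powr q + \<tau>\<^sup>2 * \<bar>b\<bar> powr q)"
      using K by (intro mult_mono) auto
    moreover have "\<bar>\<tau> * y\<bar> \<le> \<bar>b\<bar>" using True \<tau> by (simp add: abs_mult)
    ultimately show ?thesis
      using homogeneous[of "\<tau> * y" b] b unfolding K_def m_def by simp
  next
    case False
    have *: "\<bar>b + \<tau> * y\<bar> powr q + \<bar>b - \<tau> * y\<bar> powr q \<le> 2 * ((1 + K) * \<bar>\<tau> * y\<bar> powr q)"
    proof (cases "\<tau> * y = 0")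
      case True
      then show ?thesis using False by auto
    next
      case nz: False
      have le: "\<bar>b\<bar> \<le> \<bar>\<tau> * y\<bar>" using False \<tau> by (simp add: abs_mult)
      then have "(b / (\<tau> * y))\<^sup>2 \<le> 1" using nz by (simp add: abs_le_square_iff power_divide divide_simps)
      then have "K * (\<bar>\<tau> * y\<bar> powr q * (b / (\<tau> * y))\<^sup>2) \<le> K * (\<bar>\<tau> * y\<bar> powr q * 1)"
        using K by (intro mult_left_mono) auto
      then have "\<bar>\<tau> * y + b\<bar> powr q + \<bar>\<tau> * y - b\<bar> powr q \<le> 2 * ((1 + K) * \<bar>\<tau> * y\<bar> powr q)"
        using homogeneous[of b "\<tau> * y", OF le nz]
        unfolding distrib_right distrib_left mult_1_left mult_1_right by linarith
      then show ?thesis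
        by (metis add.commute abs_minus_commute)
    qed
    have "\<bar>\<tau> * y\<bar> powr q = \<tau> powr q * \<bar>y\<bar> powr q"
      using \<tau> by (simp add: abs_mult powr_mult)
    also have "\<dots> \<le> \<tau> powr m * \<bar>y\<bar> powr q"
      using \<tau>q by (rule mult_right_mono) simp
    also have "\<dots> \<le> \<tau> powr m * \<bar>y\<bar> powr q + \<tau>\<^sup>2 * \<bar>b\<bar> powr q"
      by simp
    finally have "(1 + K) * \<bar>\<tau> * y\<bar> powr q \<le> (1 + K) * (\<tau> powr m * \<bar>y\<bar> powr q + \<tau>\<^sup>2 * \<bar>b\<bar> powr q)"
      using K by (intro mult_left_mono) auto
    with * powr_ge_zero[of "\<bar>b\<bar>" q] show ?thesis
      unfolding K_def m_def distrib_left[of 2] by linarith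
  qed
qed

section \<open>The modular and the Luxemburg norm\<close>

locale variable_exponent =
  fixes M :: "'a measure" and p :: "'a \<Rightarrow> ennreal"
  assumes exponent_measurable [measurable]: "p \<in> borel_measurable M"
    and exponent_ge_1: "x \<in> space M \<Longrightarrow> 1 \<le> p x"
begin

definition finite_modular :: "('a \<Rightarrow> real) \<Rightarrow> ennreal" where
  "finite_modular g = (\<integral>\<^sup>+ x \<in> {x \<in> space M. p x < \<infinity>}. ennreal (\<bar>g x\<bar> powr enn2real (p x)) \<partial>M)"

definition top_modular :: "('a \<Rightarrow> real) \<Rightarrow> ennreal" where
  "top_modular g = esssup (restrict_space M (p -` {\<infinity>})) (\<lambda>x. ennreal \<bar>g x\<bar>)"

lemma modular_eq: "modular M p g = finite_modular g + top_modular g"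
  by (simp add: modular_def finite_modular_def top_modular_def)

lemma real_exponent_ge_1:
  assumes "x \<in> space M" "p x < \<infinity>"
  shows "1 \<le> enn2real (p x)"
  using enn2real_mono[of 1 "p x"] exponent_ge_1[OF assms(1)] assms(2) by simp

lemma top_exponent_set_AE:
  "(AE x in restrict_space M (p -` {\<infinity>}). P x) \<longleftrightarrow> (AE x in M. p x = \<infinity> \<longrightarrow> P x)"
proof -
  have "p -` {\<infinity>} \<inter> space M \<in> sets M" by measurable
  then show ?thesis
    by (subst AE_restrict_space_iff) (auto simp: Int_commute)
qed

lemma top_modular_le_iff:
  assumes [measurable]: "g \<in> borel_measurable M"
  shows "top_modular g \<le> c \<longleftrightarrow> (AE x in M. p x = \<infinity> \<longrightarrow> ennreal \<bar>g x\<bar> \<le> c)"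
proof
  have "AE x in M. p x = \<infinity> \<longrightarrow> ennreal \<bar>g x\<bar> \<le> top_modular g"
    using esssup_AE[where M = "restrict_space M (p -` {\<infinity>})" and f = "\<lambda>x. ennreal \<bar>g x\<bar>"]
    by (simp add: top_exponent_set_AE top_modular_def)
  moreover assume "top_modular g \<le> c"
  ultimately show "AE x in M. p x = \<infinity> \<longrightarrow> ennreal \<bar>g x\<bar> \<le> c"
    by (auto elim!: eventually_mono intro: order_trans)
next
  assume "AE x in M. p x = \<infinity> \<longrightarrow> ennreal \<bar>g x\<bar> \<le> c"
  then show "top_modular g \<le> c"
    unfolding top_modular_def top_exponent_set_AE[symmetric]
    by (intro esssup_I) (auto intro!: measurable_restrict_space1)
qed

lemma top_modular_AE:
  assumes "g \<in> borel_measurable M"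
  shows "AE x in M. p x = \<infinity> \<longrightarrow> ennreal \<bar>g x\<bar> \<le> top_modular g"
  using top_modular_le_iff[OF assms, of "top_modular g"] by simp

lemma finite_modular_mono:
  assumes "AE x in M. p x < \<infinity> \<longrightarrow> \<bar>g x\<bar> \<le> \<bar>h x\<bar>"
  shows "finite_modular g \<le> finite_modular h"
  unfolding finite_modular_def
  using assms
  by (intro nn_integral_mono_AE, elim eventually_mono)
    (auto split: split_indicator intro!: ennreal_leI powr_mono2)

lemma top_modular_mono:
  assumes [measurable]: "g \<in> borel_measurable M" "h \<in> borel_measurable M"
    and le: "AE x in M. p x = \<infinity> \<longrightarrow> \<bar>g x\<bar> \<le> \<bar>h x\<bar>"
  shows "top_modular g \<le> top_modular h"
proof -
  have "AE x in M. p x = \<infinity> \<longrightarrow> ennreal \<bar>g x\<bar> \<le> top_modular h"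
    using top_modular_AE[OF assms(2)] le
    by eventually_elim (auto intro: order_trans[OF ennreal_leI])
  then show ?thesis by (simp add: top_modular_le_iff)
qed

lemma modular_mono:
  assumes "g \<in> borel_measurable M" "h \<in> borel_measurable M"
    and "AE x in M. \<bar>g x\<bar> \<le> \<bar>h x\<bar>"
  shows "modular M p g \<le> modular M p h"
  unfolding modular_eq using assms
  by (intro add_mono finite_modular_mono top_modular_mono) auto

lemma top_modular_sublinear:
  assumes [measurable]: "g \<in> borel_measurable M" "h \<in> borel_measurable M"
  shows "top_modular (\<lambda>x. u * g x + v * h x) \<le> ennreal \<bar>u\<bar> * top_modular g + ennreal \<bar>v\<bar> * top_modular h"
proof (subst top_modular_le_iff)
  show "AE x in M. p x = \<infinity> \<longrightarrow>
      ennreal \<bar>u * g x + v * h x\<bar> \<le> ennreal \<bar>u\<bar> * top_modular g + ennreal \<bar>v\<bar> * top_modular h"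
    using top_modular_AE[OF assms(1)] top_modular_AE[OF assms(2)]
  proof eventually_elim
    case (elim x)
    have "ennreal \<bar>u * g x + v * h x\<bar> \<le> ennreal (\<bar>u\<bar> * \<bar>g x\<bar> + \<bar>v\<bar> * \<bar>h x\<bar>)"
      using abs_triangle_ineq[of "u * g x" "v * h x"] by (intro ennreal_leI) (simp add: abs_mult)
    also have "\<dots> = ennreal \<bar>u\<bar> * ennreal \<bar>g x\<bar> + ennreal \<bar>v\<bar> * ennreal \<bar>h x\<bar>"
      by (simp add: ennreal_mult)
    finally show ?case
      using elim by (auto intro: order_trans[OF _ add_mono[OF mult_left_mono mult_left_mono]])
  qed
qed measurable

text \<open>Convexity of the modular rests on \<open>p \<ge> 1\<close> and is the source of the triangle inequality, and of
  the decay \<open>modular_scale_le\<close>.\<close>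

lemma modular_convex:
  fixes u v :: real
  assumes [measurable]: "g \<in> borel_measurable M" "h \<in> borel_measurable M"
    and u: "0 \<le> u" and v: "0 \<le> v" and uv: "u + v = 1"
  shows "modular M p (\<lambda>x. u * g x + v * h x) \<le> ennreal u * modular M p g + ennreal v * modular M p h"
proof -
  have "finite_modular (\<lambda>x. u * g x + v * h x)
      \<le> (\<integral>\<^sup>+ x. ennreal u * (ennreal (\<bar>g x\<bar> powr enn2real (p x)) * indicator {x \<in> space M. p x < \<infinity>} x)
        + ennreal v * (ennreal (\<bar>h x\<bar> powr enn2real (p x)) * indicator {x \<in> space M. p x < \<infinity>} x) \<partial>M)"
    unfolding finite_modular_def
  proof (intro nn_integral_mono)
    fix x assume x: "x \<in> space M"
    show "ennreal (\<bar>u * g x + v * h x\<bar> powr enn2real (p x)) * indicator {x \<in> space M. p x < \<infinity>} x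
      \<le> ennreal u * (ennreal (\<bar>g x\<bar> powr enn2real (p x)) * indicator {x \<in> space M. p x < \<infinity>} x)
        + ennreal v * (ennreal (\<bar>h x\<bar> powr enn2real (p x)) * indicator {x \<in> space M. p x < \<infinity>} x)"
    proof (cases "p x < \<infinity>")
      case True
      have "ennreal (\<bar>u * g x + v * h x\<bar> powr enn2real (p x))
          \<le> ennreal (u * \<bar>g x\<bar> powr enn2real (p x) + v * \<bar>h x\<bar> powr enn2real (p x))"
        using abs_powr_convex[OF real_exponent_ge_1[OF x True] u v uv] by (rule ennreal_leI)
      then show ?thesis using True u v x by (simp add: ennreal_mult)
    qed simp
  qed
  also have "\<dots> = ennreal u * finite_modular g + ennreal v * finite_modular h"
    unfolding finite_modular_def by (simp add: nn_integral_add nn_integral_cmult)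
  finally show ?thesis
    using top_modular_sublinear[OF assms(1,2), of u v] u v
    by (auto simp: modular_eq distrib_left ac_simps intro: order_trans[OF add_mono])
qed

lemma modular_zero: "modular M p (\<lambda>x. 0) = 0"
  using top_modular_le_iff[of "\<lambda>x. 0" 0] by (simp add: modular_eq finite_modular_def)

lemma modular_scale_le:
  fixes c :: real
  assumes "g \<in> borel_measurable M" "0 \<le> c" "c \<le> 1"
  shows "modular M p (\<lambda>x. c * g x) \<le> ennreal c * modular M p g"
  using modular_convex[of g "\<lambda>x. 0" c "1 - c"] assms by (simp add: modular_zero)

lemma modular_divide_le:
  fixes a b :: real
  assumes "g \<in> borel_measurable M" "0 < a" "a \<le> b"
  shows "modular M p (\<lambda>x. g x / b) \<le> ennreal (a / b) * modular M p (\<lambda>x. g x / a)"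
  using modular_scale_le[of "\<lambda>x. g x / a" "a / b"] assms by simp

lemma var_Lebesgue_fun_borel [measurable_dest]:
  "g \<in> var_Lebesgue_fun M p \<Longrightarrow> g \<in> borel_measurable M"
  by (simp add: var_Lebesgue_fun_def)

text \<open>Convexity turns a finite modular \<open>r\<close> at scale \<open>l\<close> into one below \<open>1\<close> at scale \<open>l (r + 1)\<close>. Without
  this the infimum in the Luxemburg norm could be taken over the empty set.\<close>

lemma luxemburg_set_nonempty:
  assumes g: "g \<in> var_Lebesgue_fun M p"
  shows "{\<alpha>. \<alpha> > 0 \<and> modular M p (\<lambda>x. g x / \<alpha>) \<le> 1} \<noteq> {}"
proof -
  obtain l where l: "l > 0" "modular M p (\<lambda>x. g x / l) < \<infinity>"
    using g by (auto simp: var_Lebesgue_fun_def)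
  then obtain r where r: "0 \<le> r" "modular M p (\<lambda>x. g x / l) = ennreal r"
    by (auto simp: less_top_ennreal)
  have "modular M p (\<lambda>x. g x / (l * (r + 1))) \<le> ennreal (l / (l * (r + 1))) * modular M p (\<lambda>x. g x / l)"
    using l r g by (intro modular_divide_le) (auto simp: algebra_simps var_Lebesgue_fun_def)
  also have "\<dots> = ennreal (r / (r + 1))"
    using l r by (simp flip: ennreal_mult'')
  also have "\<dots> \<le> 1"
    using r by simp
  finally show ?thesis
    using l r by (auto intro!: exI[of _ "l * (r + 1)"])
qed

lemma luxemburg_nonneg: "0 \<le> luxemburg M p g" if "g \<in> var_Lebesgue_fun M p"
  using luxemburg_set_nonempty[OF that] unfolding luxemburg_def by (intro cInf_greatest) auto

lemma luxemburg_le: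
  assumes "\<alpha> > 0" "modular M p (\<lambda>x. g x / \<alpha>) \<le> 1"
  shows "luxemburg M p g \<le> \<alpha>"
  unfolding luxemburg_def using assms by (intro cInf_lower) (auto intro!: bdd_belowI[of _ 0])

lemma modular_le_1_of_luxemburg_less:
  assumes g: "g \<in> var_Lebesgue_fun M p" and less: "luxemburg M p g < \<alpha>"
  shows "modular M p (\<lambda>x. g x / \<alpha>) \<le> 1"
proof -
  note [measurable] = g[THEN var_Lebesgue_fun_borel]
  from less obtain \<beta> where \<beta>: "0 < \<beta>" "modular M p (\<lambda>x. g x / \<beta>) \<le> 1" "\<beta> < \<alpha>"
    unfolding luxemburg_def by (subst (asm) cInf_less_iff[OF luxemburg_set_nonempty[OF g]]) (auto intro!: bdd_belowI[of _ 0])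
  have "modular M p (\<lambda>x. g x / \<alpha>) \<le> modular M p (\<lambda>x. g x / \<beta>)"
    using \<beta> by (intro modular_mono) (auto intro!: divide_left_mono)
  then show ?thesis using \<beta> by simp
qed

text \<open>The sum is the convex combination of \<open>g / a\<close> and \<open>h / b\<close> with weights \<open>a / (a + b)\<close> and
  \<open>b / (a + b)\<close>.\<close>

lemma modular_add_convex:
  fixes a b :: real
  assumes [measurable]: "g \<in> borel_measurable M" "h \<in> borel_measurable M"
    and ab: "0 < a" "0 < b"
  shows "modular M p (\<lambda>x. (g x + h x) / (a + b))
    \<le> ennreal (a / (a + b)) * modular M p (\<lambda>x. g x / a) + ennreal (b / (a + b)) * modular M p (\<lambda>x. h x / b)"
proof -
  have "(\<lambda>x. (g x + h x) / (a + b)) = (\<lambda>x. a / (a + b) * (g x / a) + b / (a + b) * (h x / b))"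
    using ab by (simp add: add_divide_distrib)
  moreover have "a / (a + b) + b / (a + b) = 1" using ab by (simp flip: add_divide_distrib)
  ultimately show ?thesis
    using modular_convex[of "\<lambda>x. g x / a" "\<lambda>x. h x / b" "a / (a + b)" "b / (a + b)"] ab by simp
qed

lemma var_Lebesgue_fun_add:
  assumes "g \<in> var_Lebesgue_fun M p" "h \<in> var_Lebesgue_fun M p"
  shows "(\<lambda>x. g x + h x) \<in> var_Lebesgue_fun M p"
proof -
  note [measurable] = assms[THEN var_Lebesgue_fun_borel]
  obtain a b where ab: "0 < a" "modular M p (\<lambda>x. g x / a) < \<infinity>" "0 < b" "modular M p (\<lambda>x. h x / b) < \<infinity>"
    using assms by (auto simp: var_Lebesgue_fun_def)
  have "modular M p (\<lambda>x. (g x + h x) / (a + b)) < \<infinity>"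
    using ab by (intro le_less_trans[OF modular_add_convex]) (auto simp: ennreal_mult_less_top)
  then show ?thesis
    using ab by (auto simp: var_Lebesgue_fun_def intro!: exI[of _ "a + b"])
qed

lemma var_Lebesgue_fun_scale:
  assumes "g \<in> var_Lebesgue_fun M p"
  shows "(\<lambda>x. c * g x) \<in> var_Lebesgue_fun M p"
proof -
  note [measurable] = assms[THEN var_Lebesgue_fun_borel]
  obtain a where a: "0 < a" "modular M p (\<lambda>x. g x / a) < \<infinity>"
    using assms by (auto simp: var_Lebesgue_fun_def)
  have "modular M p (\<lambda>x. c * g x / (a * (\<bar>c\<bar> + 1))) \<le> modular M p (\<lambda>x. g x / a)"
  proof (intro modular_mono AE_I2)
    fix x
    have "\<bar>c * g x / (a * (\<bar>c\<bar> + 1))\<bar> = \<bar>c\<bar> / (\<bar>c\<bar> + 1) * \<bar>g x / a\<bar>"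
      using a by (simp add: abs_mult)
    also have "\<dots> \<le> 1 * \<bar>g x / a\<bar>"
      by (intro mult_right_mono) auto
    finally show "\<bar>c * g x / (a * (\<bar>c\<bar> + 1))\<bar> \<le> \<bar>g x / a\<bar>" by simp
  qed measurable
  then show ?thesis
    using a by (auto simp: var_Lebesgue_fun_def intro!: exI[of _ "a * (\<bar>c\<bar> + 1)"] elim: le_less_trans)
qed

lemma var_Lebesgue_fun_zero: "(\<lambda>x. 0) \<in> var_Lebesgue_fun M p"
  by (auto simp: var_Lebesgue_fun_def modular_zero intro!: exI[of _ 1])

lemma luxemburg_triangle:
  assumes g: "g \<in> var_Lebesgue_fun M p" and h: "h \<in> var_Lebesgue_fun M p"
  shows "luxemburg M p (\<lambda>x. g x + h x) \<le> luxemburg M p g + luxemburg M p h"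
proof (rule field_le_epsilon)
  fix e :: real assume e: "0 < e"
  define a where "a = luxemburg M p g + e / 2"
  define b where "b = luxemburg M p h + e / 2"
  have ab: "0 < a" "0 < b"
    using luxemburg_nonneg[OF g] luxemburg_nonneg[OF h] e by (auto simp: a_def b_def)
  have le: "modular M p (\<lambda>x. g x / a) \<le> 1" "modular M p (\<lambda>x. h x / b) \<le> 1"
    using e by (auto intro!: modular_le_1_of_luxemburg_less g h simp: a_def b_def)
  have "modular M p (\<lambda>x. (g x + h x) / (a + b))
      \<le> ennreal (a / (a + b)) * modular M p (\<lambda>x. g x / a) + ennreal (b / (a + b)) * modular M p (\<lambda>x. h x / b)"
    using ab g h by (intro modular_add_convex) (auto simp: var_Lebesgue_fun_def)
  also have "\<dots> \<le> ennreal (a / (a + b)) * 1 + ennreal (b / (a + b)) * 1"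
    using le by (intro add_mono mult_left_mono) auto
  also have "\<dots> = ennreal ((a + b) / (a + b))"
    using ab by (simp only: add_divide_distrib) (simp flip: ennreal_plus)
  finally have "luxemburg M p (\<lambda>x. g x + h x) \<le> a + b"
    using ab by (intro luxemburg_le) auto
  then show "luxemburg M p (\<lambda>x. g x + h x) \<le> luxemburg M p g + luxemburg M p h + e"
    by (simp add: a_def b_def)
qed

lemma luxemburg_minus: "luxemburg M p (\<lambda>x. - g x) = luxemburg M p g"
proof -
  have "modular M p (\<lambda>x. - g x / \<alpha>) = modular M p (\<lambda>x. g x / \<alpha>)" for \<alpha>
    unfolding modular_def by simp
  then show ?thesis by (simp add: luxemburg_def)
qed

end

section \<open>Atoms and disjoint sequences of non-null sets\<close>

text \<open>If \<open>S\<close> fails for \<open>A\<close>, then \<open>A\<close> is not an atom, so it splits into two non-null parts, and \<open>S\<close> fails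
  for one of them. Iterating on the bad part, the parts that are split off are disjoint and non-null.\<close>

lemma disjoint_nonnull_sequence:
  assumes A: "A \<in> sets M" "\<not> S A"
    and atom: "\<And>B. B \<in> sets M \<Longrightarrow> B \<subseteq> A \<Longrightarrow>
      (\<And>C. C \<in> sets M \<Longrightarrow> C \<subseteq> B \<Longrightarrow> C \<in> null_sets M \<or> B - C \<in> null_sets M) \<Longrightarrow> S B"
    and union: "\<And>B C. B \<in> sets M \<Longrightarrow> C \<in> sets M \<Longrightarrow> B \<union> C \<subseteq> A \<Longrightarrow> B \<inter> C = {} \<Longrightarrow>
      S B \<Longrightarrow> S C \<Longrightarrow> S (B \<union> C)"
  obtains D :: "nat \<Rightarrow> 'a set"
  where "disjoint_family D" "\<And>n. D n \<in> sets M" "\<And>n. D n \<subseteq> A" "\<And>n. D n \<notin> null_sets M"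
proof -
  have step: "\<exists>B'. (B' \<in> sets M \<and> B' \<subseteq> A \<and> \<not> S B') \<and> (B' \<subseteq> B \<and> B - B' \<notin> null_sets M)"
    if B: "B \<in> sets M \<and> B \<subseteq> A \<and> \<not> S B" for B
  proof -
    obtain C where C: "C \<in> sets M" "C \<subseteq> B" "C \<notin> null_sets M" "B - C \<notin> null_sets M"
      using atom[of B] B by blast
    have "\<not> S C \<or> \<not> S (B - C)"
      using union[of C "B - C"] B C by (auto simp: Un_absorb1)
    then show ?thesis
    proof
      assume "\<not> S C"
      then show ?thesis using B C by (intro exI[of _ C]) auto
    next
      assume "\<not> S (B - C)"
      moreover have "B - (B - C) = C" using C by auto
      ultimately show ?thesis using B C by (intro exI[of _ "B - C"]) auto
    qed
  qed
  have "\<exists>B. \<forall>n. (B n \<in> sets M \<and> B n \<subseteq> A \<and> \<not> S (B n)) \<and>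
      (B (Suc n) \<subseteq> B n \<and> B n - B (Suc n) \<notin> null_sets M)"
  proof (rule dependent_nat_choice)
    show "\<exists>B. B \<in> sets M \<and> B \<subseteq> A \<and> \<not> S B" using A by blast
  qed (rule step)
  then obtain B where B: "\<And>n. B n \<in> sets M \<and> B n \<subseteq> A \<and> \<not> S (B n)"
      and next_subset: "\<And>n. B (Suc n) \<subseteq> B n" and diff: "\<And>n. B n - B (Suc n) \<notin> null_sets M"
    by blast
  have subset: "B n \<subseteq> B m" if "m \<le> n" for m n
    using next_subset that by (rule lift_Suc_antimono_le)
  show thesis
  proof
    show "disjoint_family (\<lambda>n. B n - B (Suc n))"
      unfolding disjoint_family_on_def
    proof (intro ballI impI)
      fix m n :: nat
      assume "m \<noteq> n"
      then have "Suc m \<le> n \<or> Suc n \<le> m" by auto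
      then show "(B m - B (Suc m)) \<inter> (B n - B (Suc n)) = {}"
        using subset[of "Suc m" n] subset[of "Suc n" m] by auto
    qed
  qed (use B diff in auto)
qed

text \<open>On an atom each condition \<open>f\<^sub>i < q\<close> with \<open>q\<close> rational holds almost everywhere or almost nowhere.
  Countably many such conditions determine all values \<open>f\<^sub>i x\<close>.\<close>

lemma AE_constant_on_atom:
  fixes f :: "'i::countable \<Rightarrow> 'a \<Rightarrow> real"
  assumes B: "B \<in> sets M" and [measurable]: "\<And>i. f i \<in> borel_measurable M"
    and atom: "\<And>C. C \<in> sets M \<Longrightarrow> C \<subseteq> B \<Longrightarrow> C \<in> null_sets M \<or> B - C \<in> null_sets M"
  obtains c where "AE x in M. x \<in> B \<longrightarrow> (\<forall>i. f i x = c i)"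
proof (cases "B \<in> null_sets M")
  case True
  then have "AE x in M. x \<notin> B" by (rule AE_not_in)
  then show thesis by (intro that) (auto elim: eventually_mono)
next
  case False
  have "\<exists>b. AE x in M. x \<in> B \<longrightarrow> (f i x < of_rat q \<longleftrightarrow> b)" for i q
  proof -
    define C where "C = {x \<in> space M. f i x < of_rat q} \<inter> B"
    have C: "C \<in> sets M" "C \<subseteq> B" using B by (auto simp: C_def)
    from atom[OF this] show ?thesis
    proof
      assume "C \<in> null_sets M"
      then have "AE x in M. x \<notin> C" by (rule AE_not_in)
      then show ?thesis
        using AE_space by (intro exI[of _ False], eventually_elim) (auto simp: C_def)
    next
      assume "B - C \<in> null_sets M"
      then have "AE x in M. x \<notin> B - C" by (rule AE_not_in)
      then show ?thesis
        by (intro exI[of _ True], eventually_elim) (auto simp: C_def)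
    qed
  qed
  then obtain b where "\<And>i q. AE x in M. x \<in> B \<longrightarrow> (f i x < of_rat q \<longleftrightarrow> b i q)" by metis
  then have "AE x in M. \<forall>q. x \<in> B \<longrightarrow> (f i x < of_rat q \<longleftrightarrow> b i q)" for i
    by (intro AE_all_countable[THEN iffD2] allI)
  then have ae: "AE x in M. \<forall>i q. x \<in> B \<longrightarrow> (f i x < of_rat q \<longleftrightarrow> b i q)"
    by (intro AE_all_countable[THEN iffD2, of "\<lambda>i x. \<forall>q. x \<in> B \<longrightarrow> (f i x < of_rat q \<longleftrightarrow> b i q)"] allI)
  obtain x0 where x0: "x0 \<in> B" "\<And>i q. f i x0 < of_rat q \<longleftrightarrow> b i q"
  proof (rule ccontr)
    assume "\<not> thesis"
    then have "AE x in M. x \<notin> B"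
      using ae that by (auto elim!: eventually_mono)
    then show False
      using False B by (auto simp: AE_iff_null_sets)
  qed
  show thesis
  proof (rule that)
    show "AE x in M. x \<in> B \<longrightarrow> (\<forall>i. f i x = f i x0)"
      using ae
    proof eventually_elim
      case (elim x)
      show ?case
      proof (intro impI allI)
        fix i assume "x \<in> B"
        then have same: "f i x < of_rat q \<longleftrightarrow> f i x0 < of_rat q" for q
          using elim x0 by blast
        show "f i x = f i x0"
        proof (rule ccontr)
          assume "f i x \<noteq> f i x0"
          then consider "f i x < f i x0" | "f i x0 < f i x" by linarith
          then show False
          proof cases
            case 1
            from of_rat_dense[OF this] show False using same by (metis less_asym)
          next
            case 2
            from of_rat_dense[OF this] show False using same by (metis less_asym)
          qed
        qed
      qed
    qed
  qed
qed

section \<open>Precompactness where the exponent is 1 or infinite\<close>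

context variable_exponent
begin

definition modular_Cauchy_on :: "'a set \<Rightarrow> (nat \<Rightarrow> 'a \<Rightarrow> real) \<Rightarrow> bool" where
  "modular_Cauchy_on B f \<longleftrightarrow>
     (\<forall>d>0. \<exists>m. \<forall>i\<ge>m. \<forall>j\<ge>m. modular M p (\<lambda>x. (f i x - f j x) * indicator B x) \<le> ennreal d)"

text \<open>The unit ball of the functions on \<open>B\<close> is sequentially precompact for the modular. A set on
  which the exponent is \<open>1\<close> or \<open>\<infinity>\<close> has this property if it is a finite union of atoms up to a null
  set; otherwise it contains infinitely many disjoint non-null sets. In this form the property can be
  used without knowing the atoms.\<close>

definition precompact_on :: "'a set \<Rightarrow> bool" where
  "precompact_on B \<longleftrightarrow> (\<forall>f :: nat \<Rightarrow> 'a \<Rightarrow> real.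
     (\<forall>n. f n \<in> borel_measurable M \<and> modular M p (\<lambda>x. f n x * indicator B x) \<le> 1) \<longrightarrow>
     (\<exists>r. strict_mono r \<and> modular_Cauchy_on B (\<lambda>n. f (r n))))"

lemma modular_Cauchy_onD:
  assumes "modular_Cauchy_on B f" "0 < d"
  obtains m where "\<And>i j. m \<le> i \<Longrightarrow> m \<le> j \<Longrightarrow>
    modular M p (\<lambda>x. (f i x - f j x) * indicator B x) \<le> ennreal d"
  using assms unfolding modular_Cauchy_on_def by blast

lemma precompact_onD:
  fixes f :: "nat \<Rightarrow> 'a \<Rightarrow> real"
  assumes "precompact_on B" "\<And>n. f n \<in> borel_measurable M"
    and "\<And>n. modular M p (\<lambda>x. f n x * indicator B x) \<le> 1"
  obtains r where "strict_mono r" "modular_Cauchy_on B (\<lambda>n. f (r n))"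
  using assms(1)[unfolded precompact_on_def, rule_format, of f] assms(2,3) by blast

definition endpoint_set :: "'a set" where
  "endpoint_set = {x \<in> space M. p x = 1 \<or> p x = \<infinity>}"

lemma endpoint_set_sets [measurable]: "endpoint_set \<in> sets M"
  unfolding endpoint_set_def by measurable

text \<open>Where the exponent is \<open>1\<close> or \<open>\<infinity>\<close> the modular is built from the \<open>L\<^sub>1\<close> norm and the
  essential supremum, so it is homogeneous and subadditive rather than merely convex.\<close>

lemma modular_sublinear_endpoint:
  fixes u v :: real
  assumes [measurable]: "g \<in> borel_measurable M" "h \<in> borel_measurable M"
    and B: "B \<in> sets M" "B \<subseteq> endpoint_set"
  shows "modular M p (\<lambda>x. (u * g x + v * h x) * indicator B x)
    \<le> ennreal \<bar>u\<bar> * modular M p (\<lambda>x. g x * indicator B x) + ennreal \<bar>v\<bar> * modular M p (\<lambda>x. h x * indicator B x)"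
proof -
  note [measurable] = B(1)
  let ?F = "\<lambda>g x. ennreal (\<bar>g x * indicator B x\<bar> powr enn2real (p x)) * indicator {x \<in> space M. p x < \<infinity>} x"
  have "finite_modular (\<lambda>x. (u * g x + v * h x) * indicator B x)
      \<le> (\<integral>\<^sup>+ x. ennreal \<bar>u\<bar> * ?F g x + ennreal \<bar>v\<bar> * ?F h x \<partial>M)"
    unfolding finite_modular_def
  proof (intro nn_integral_mono)
    fix x assume x: "x \<in> space M"
    show "?F (\<lambda>x. u * g x + v * h x) x \<le> ennreal \<bar>u\<bar> * ?F g x + ennreal \<bar>v\<bar> * ?F h x"
    proof (cases "x \<in> B \<and> p x = 1")
      case True
      have "ennreal \<bar>u * g x + v * h x\<bar> \<le> ennreal (\<bar>u\<bar> * \<bar>g x\<bar> + \<bar>v\<bar> * \<bar>h x\<bar>)"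
        using abs_triangle_ineq[of "u * g x" "v * h x"] by (intro ennreal_leI) (simp add: abs_mult)
      then show ?thesis using True x by (simp add: ennreal_mult)
    next
      case False
      then have "x \<notin> B \<or> \<not> p x < \<infinity>" using B by (auto simp: endpoint_set_def)
      then show ?thesis by auto
    qed
  qed
  also have "\<dots> = ennreal \<bar>u\<bar> * finite_modular (\<lambda>x. g x * indicator B x)
      + ennreal \<bar>v\<bar> * finite_modular (\<lambda>x. h x * indicator B x)"
    unfolding finite_modular_def by (simp add: nn_integral_add nn_integral_cmult)
  moreover have "top_modular (\<lambda>x. (u * g x + v * h x) * indicator B x)
      \<le> ennreal \<bar>u\<bar> * top_modular (\<lambda>x. g x * indicator B x) + ennreal \<bar>v\<bar> * top_modular (\<lambda>x. h x * indicator B x)"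
    using top_modular_sublinear[of "\<lambda>x. g x * indicator B x" "\<lambda>x. h x * indicator B x" u v]
    by (simp add: distrib_right mult.assoc)
  ultimately show ?thesis
    by (auto simp: modular_eq distrib_left ac_simps intro: order_trans[OF add_mono])
qed

lemma modular_indicator_Un_le:
  assumes [measurable]: "g \<in> borel_measurable M" "B \<in> sets M" "C \<in> sets M"
    and sub: "B \<union> C \<subseteq> endpoint_set" and disj: "B \<inter> C = {}"
  shows "modular M p (\<lambda>x. g x * indicator (B \<union> C) x)
    \<le> modular M p (\<lambda>x. g x * indicator B x) + modular M p (\<lambda>x. g x * indicator C x)"
proof -
  have "(\<lambda>x. (1 * (g x * indicator B x) + 1 * (g x * indicator C x)) * indicator (B \<union> C) x)
      = (\<lambda>x. g x * indicator (B \<union> C) x)"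
    using disj by (auto simp: fun_eq_iff split: split_indicator)
  moreover have "(\<lambda>x. g x * indicator B x * indicator (B \<union> C) x) = (\<lambda>x. g x * indicator B x :: real)"
    "(\<lambda>x. g x * indicator C x * indicator (B \<union> C) x) = (\<lambda>x. g x * indicator C x :: real)"
    by (auto simp: fun_eq_iff split: split_indicator)
  ultimately show ?thesis
    using modular_sublinear_endpoint[of "\<lambda>x. g x * indicator B x" "\<lambda>x. g x * indicator C x" "B \<union> C" 1 1] sub
    by simp
qed

lemma precompact_on_Un:
  assumes BC [measurable]: "B \<in> sets M" "C \<in> sets M"
    and sub: "B \<union> C \<subseteq> endpoint_set" and disj: "B \<inter> C = {}"
    and B: "precompact_on B" and C: "precompact_on C"
  shows "precompact_on (B \<union> C)"
  unfolding precompact_on_def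
proof (intro allI impI)
  fix f :: "nat \<Rightarrow> 'a \<Rightarrow> real"
  assume f: "\<forall>n. f n \<in> borel_measurable M \<and> modular M p (\<lambda>x. f n x * indicator (B \<union> C) x) \<le> 1"
  have [measurable]: "\<And>n. f n \<in> borel_measurable M" using f by blast
  have le: "modular M p (\<lambda>x. f n x * indicator B' x) \<le> 1"
    if [measurable]: "B' \<in> sets M" and sub': "B' \<subseteq> B \<union> C" for B' n
  proof -
    have "modular M p (\<lambda>x. f n x * indicator B' x) \<le> modular M p (\<lambda>x. f n x * indicator (B \<union> C) x)"
      using sub' by (intro modular_mono) (auto split: split_indicator)
    with f show ?thesis using order_trans by blast
  qed
  obtain r where r: "strict_mono r" "modular_Cauchy_on B (\<lambda>n. f (r n))"
    by (rule precompact_onD[OF B, of f]) (auto intro: le)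
  obtain s where s: "strict_mono s" "modular_Cauchy_on C (\<lambda>n. f (r (s n)))"
    by (rule precompact_onD[OF C, of "\<lambda>n. f (r n)"]) (auto intro: le)
  show "\<exists>r. strict_mono r \<and> modular_Cauchy_on (B \<union> C) (\<lambda>n. f (r n))"
  proof (intro exI conjI)
    show "strict_mono (\<lambda>n. r (s n))" using r(1) s(1) by (simp add: strict_mono_def)
    show "modular_Cauchy_on (B \<union> C) (\<lambda>n. f (r (s n)))"
      unfolding modular_Cauchy_on_def
    proof (intro allI impI)
      fix d :: real assume "0 < d"
      then have d: "0 < d / 2" by simp
      obtain m where m: "\<And>i j. m \<le> i \<Longrightarrow> m \<le> j \<Longrightarrow>
          modular M p (\<lambda>x. (f (r i) x - f (r j) x) * indicator B x) \<le> ennreal (d / 2)"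
        using modular_Cauchy_onD[OF r(2) d] by blast
      obtain n where n: "\<And>i j. n \<le> i \<Longrightarrow> n \<le> j \<Longrightarrow>
          modular M p (\<lambda>x. (f (r (s i)) x - f (r (s j)) x) * indicator C x) \<le> ennreal (d / 2)"
        using modular_Cauchy_onD[OF s(2) d] by blast
      have "modular M p (\<lambda>x. (f (r (s i)) x - f (r (s j)) x) * indicator (B \<union> C) x) \<le> ennreal d"
        if "max m n \<le> i" "max m n \<le> j" for i j
      proof -
        have ge: "i \<le> s i" "j \<le> s j" using s(1) by (auto intro: strict_mono_imp_increasing)
        have "modular M p (\<lambda>x. (f (r (s i)) x - f (r (s j)) x) * indicator (B \<union> C) x)
          \<le> modular M p (\<lambda>x. (f (r (s i)) x - f (r (s j)) x) * indicator B x)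
            + modular M p (\<lambda>x. (f (r (s i)) x - f (r (s j)) x) * indicator C x)"
          using sub disj by (intro modular_indicator_Un_le) auto
        also have "\<dots> \<le> ennreal (d / 2) + ennreal (d / 2)"
          using that ge by (intro add_mono m n) auto
        also have "\<dots> = ennreal d" using \<open>0 < d\<close> by (simp flip: ennreal_plus)
        finally show ?thesis .
      qed
      then show "\<exists>m. \<forall>i\<ge>m. \<forall>j\<ge>m.
          modular M p (\<lambda>x. (f (r (s i)) x - f (r (s j)) x) * indicator (B \<union> C) x) \<le> ennreal d"
        by blast
    qed
  qed
qed

text \<open>All functions are constant on the atom, so their constants form a bounded real sequence, unless the
  indicator of the atom has modular \<open>0\<close> or \<open>\<infinity>\<close>, in which case all differences have modular \<open>0\<close>.\<close>

lemma precompact_on_atom: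
  assumes B [measurable]: "B \<in> sets M" and sub: "B \<subseteq> endpoint_set"
    and atom: "\<And>C. C \<in> sets M \<Longrightarrow> C \<subseteq> B \<Longrightarrow> C \<in> null_sets M \<or> B - C \<in> null_sets M"
  shows "precompact_on B"
  unfolding precompact_on_def
proof (intro allI impI)
  fix f :: "nat \<Rightarrow> 'a \<Rightarrow> real"
  assume f: "\<forall>n. f n \<in> borel_measurable M \<and> modular M p (\<lambda>x. f n x * indicator B x) \<le> 1"
  have [measurable]: "\<And>n. f n \<in> borel_measurable M" using f by blast
  obtain c where c: "AE x in M. x \<in> B \<longrightarrow> (\<forall>n. f n x = c n)"
    using AE_constant_on_atom[OF B _ atom, of f] by auto
  define \<mu> where "\<mu> = modular M p (\<lambda>x. 1 * indicator B x)"
  have scale: "modular M p (\<lambda>x. a * indicator B x) \<le> ennreal \<bar>a\<bar> * \<mu>" for a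
    using modular_sublinear_endpoint[of "\<lambda>x. 1" "\<lambda>x. 1" B a 0] sub by (simp add: \<mu>_def)
  have diff: "modular M p (\<lambda>x. (f i x - f j x) * indicator B x) \<le> ennreal \<bar>c i - c j\<bar> * \<mu>" for i j
  proof -
    have "modular M p (\<lambda>x. (f i x - f j x) * indicator B x) \<le> modular M p (\<lambda>x. (c i - c j) * indicator B x)"
      using c by (intro modular_mono) (auto elim!: eventually_mono split: split_indicator)
    also note scale
    finally show ?thesis .
  qed
  have bounded: "ennreal \<bar>c n\<bar> * \<mu> \<le> 1" for n
  proof (cases "c n = 0")
    case False
    have "\<mu> \<le> ennreal \<bar>1 / c n\<bar> * modular M p (\<lambda>x. c n * indicator B x)"
      using modular_sublinear_endpoint[of "\<lambda>x. c n" "\<lambda>x. 0" B "1 / c n" 0] sub False by (simp add: \<mu>_def)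
    also have "modular M p (\<lambda>x. c n * indicator B x) \<le> modular M p (\<lambda>x. f n x * indicator B x)"
      using c by (intro modular_mono) (auto elim!: eventually_mono split: split_indicator)
    also have "\<dots> \<le> 1" using f by simp
    finally have "\<mu> \<le> ennreal \<bar>1 / c n\<bar>" by (simp add: mult_left_mono)
    then have "ennreal \<bar>c n\<bar> * \<mu> \<le> ennreal \<bar>c n\<bar> * ennreal \<bar>1 / c n\<bar>" by (rule mult_left_mono) simp
    also have "\<dots> = 1" using False by (simp flip: ennreal_mult)
    finally show ?thesis .
  qed simp
  show "\<exists>r. strict_mono r \<and> modular_Cauchy_on B (\<lambda>n. f (r n))"
  proof (cases "0 < \<mu> \<and> \<mu> < \<infinity>")
    case False
    have zero: "ennreal \<bar>c i - c j\<bar> * \<mu> = 0" for i j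
    proof (cases "\<mu> = 0")
      case nz: False
      with False have top: "\<mu> = \<infinity>"
        by (auto simp: not_less zero_less_iff_neq_zero top_unique)
      have "c n = 0" for n
      proof (rule ccontr)
        assume "c n \<noteq> 0"
        then have "ennreal \<bar>c n\<bar> * \<mu> = \<infinity>" unfolding top by (simp add: ennreal_mult_eq_top_iff)
        with bounded[of n] have "(\<infinity> :: ennreal) \<le> 1" by metis
        then show False by (simp add: top_unique)
      qed
      then show ?thesis by simp
    qed simp
    have "modular M p (\<lambda>x. (f i x - f j x) * indicator B x) \<le> ennreal d" for i j d
      using diff[of i j] unfolding zero by simp
    then have "modular_Cauchy_on B (\<lambda>n. f (id n))" by (simp add: modular_Cauchy_on_def)
    then show ?thesis using strict_mono_id by blast
  next
    case True
    then obtain u where u: "\<mu> = ennreal u" "0 < u" by (cases \<mu>) auto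
    have "\<bar>c n\<bar> \<le> 1 / u" for n
    proof -
      have "ennreal (\<bar>c n\<bar> * u) \<le> 1" using bounded[of n] u by (simp add: ennreal_mult)
      then show ?thesis using u by (simp add: field_simps)
    qed
    then have "bounded (range c)" by (auto simp: bounded_iff)
    then obtain l r where r: "strict_mono r" "(c \<circ> r) \<longlonglongrightarrow> l"
      using bounded_imp_convergent_subsequence by blast
    then have Cauchy: "Cauchy (c \<circ> r)" by (simp add: LIMSEQ_imp_Cauchy)
    have "modular_Cauchy_on B (\<lambda>n. f (r n))"
      unfolding modular_Cauchy_on_def
    proof (intro allI impI)
      fix d :: real assume "0 < d"
      with u have "0 < d / u" by simp
      with Cauchy obtain m where m: "\<And>i j. i \<ge> m \<Longrightarrow> j \<ge> m \<Longrightarrow> \<bar>c (r i) - c (r j)\<bar> < d / u"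
        unfolding Cauchy_def dist_real_def o_def by meson
      have "modular M p (\<lambda>x. (f (r i) x - f (r j) x) * indicator B x) \<le> ennreal d"
        if "m \<le> i" "m \<le> j" for i j
      proof -
        have "\<bar>c (r i) - c (r j)\<bar> * u \<le> d" using m[OF that] u by (simp add: field_simps)
        then have "ennreal \<bar>c (r i) - c (r j)\<bar> * \<mu> \<le> ennreal d"
          using u by (simp add: ennreal_leI flip: ennreal_mult)
        with diff show ?thesis using order_trans by blast
      qed
      then show "\<exists>m. \<forall>i\<ge>m. \<forall>j\<ge>m. modular M p (\<lambda>x. (f (r i) x - f (r j) x) * indicator B x) \<le> ennreal d"
        by blast
    qed
    with r(1) show ?thesis by blast
  qed
qed

lemma disjoint_sequence_of_not_precompact:
  assumes A: "A \<in> sets M" "A \<subseteq> endpoint_set" "\<not> precompact_on A"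
  obtains D :: "nat \<Rightarrow> 'a set"
  where "disjoint_family D" "\<And>n. D n \<in> sets M" "\<And>n. D n \<subseteq> A" "\<And>n. D n \<notin> null_sets M"
proof (rule disjoint_nonnull_sequence[where S = precompact_on, OF A(1,3)])
  fix B assume "B \<in> sets M" "B \<subseteq> A"
    "\<And>C. C \<in> sets M \<Longrightarrow> C \<subseteq> B \<Longrightarrow> C \<in> null_sets M \<or> B - C \<in> null_sets M"
  then show "precompact_on B" using A(2) by (intro precompact_on_atom) auto
next
  fix B C assume "B \<in> sets M" "C \<in> sets M" "B \<union> C \<subseteq> A" "B \<inter> C = {}" "precompact_on B" "precompact_on C"
  then show "precompact_on (B \<union> C)" using A(2) by (intro precompact_on_Un) auto
qed (rule that)

end

section \<open>Smoothness of the modular at intermediate exponents\<close>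

context variable_exponent
begin

text \<open>The part of the remainder in \<open>abs_powr_smooth_le\<close> that depends only on the direction \<open>y\<close> of the
  perturbation.\<close>

definition intermediate_modular :: "real \<Rightarrow> ('a \<Rightarrow> real) \<Rightarrow> ennreal" where
  "intermediate_modular \<tau> y = (\<integral>\<^sup>+ x \<in> {x \<in> space M. 1 < p x \<and> p x < \<infinity>}.
     ennreal (\<tau> powr min (enn2real (p x)) 2 * \<bar>y x\<bar> powr enn2real (p x)) \<partial>M)"

lemma real_exponent_gt_1:
  assumes "1 < p x" "p x < \<infinity>"
  shows "1 < enn2real (p x)"
proof (rule ccontr)
  assume "\<not> 1 < enn2real (p x)"
  then have "ennreal (enn2real (p x)) \<le> ennreal 1" by (intro ennreal_leI) simp
  with assms show False by simp
qed

text \<open>Where \<open>1 < p < \<infinity>\<close> the pointwise inequality \<open>abs_powr_smooth_le\<close> is integrated; where \<open>p\<close> is \<open>1\<close> or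
  \<open>\<infinity>\<close> only the triangle inequality is available, and the perturbation costs a first-order term.
  Apart from \<open>modular M p g\<close>, the bound does not depend on \<open>g\<close>.\<close>

lemma modular_smooth_le:
  fixes P \<tau> :: real
  assumes gy [measurable]: "g \<in> borel_measurable M" "y \<in> borel_measurable M"
    and P: "AE x in M. p x < \<infinity> \<longrightarrow> enn2real (p x) \<le> P"
    and \<tau>: "0 < \<tau>" "\<tau> \<le> 1"
  defines "C \<equiv> ennreal (1 + P\<^sup>2 * exp P)"
  shows "modular M p (\<lambda>x. g x + \<tau> * y x) + modular M p (\<lambda>x. g x - \<tau> * y x)
    \<le> 2 * (modular M p g + ennreal \<tau> * modular M p (\<lambda>x. y x * indicator endpoint_set x)
        + C * (intermediate_modular \<tau> y + ennreal (\<tau>\<^sup>2) * modular M p g))"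
proof -
  let ?F = "\<lambda>f x. ennreal (\<bar>f x\<bar> powr enn2real (p x)) * indicator {x \<in> space M. p x < \<infinity>} x"
  let ?I = "\<lambda>x. ennreal (\<tau> powr min (enn2real (p x)) 2 * \<bar>y x\<bar> powr enn2real (p x))
    * indicator {x \<in> space M. 1 < p x \<and> p x < \<infinity>} x"
  let ?yE = "\<lambda>x. y x * indicator endpoint_set x"
  have "finite_modular (\<lambda>x. g x + \<tau> * y x) + finite_modular (\<lambda>x. g x - \<tau> * y x)
      = (\<integral>\<^sup>+ x. ?F (\<lambda>x. g x + \<tau> * y x) x + ?F (\<lambda>x. g x - \<tau> * y x) x \<partial>M)"
    unfolding finite_modular_def by (simp add: nn_integral_add)
  also have "\<dots> \<le> (\<integral>\<^sup>+ x. 2 * (?F g x + ennreal \<tau> * ?F ?yE x + C * (?I x + ennreal (\<tau>\<^sup>2) * ?F g x)) \<partial>M)"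
  proof (intro nn_integral_mono_AE, use P AE_space in eventually_elim)
    case (elim x)
    consider "p x = \<infinity>" | "p x = 1" | "1 < p x" "p x < \<infinity>"
      using exponent_ge_1[OF elim(2)] by (metis order_le_less top.not_eq_extremum infinity_ennreal_def)
    then show ?case
    proof cases
      case 1
      then show ?thesis by simp
    next
      case 2
      have "?F (\<lambda>x. g x + \<tau> * y x) x + ?F (\<lambda>x. g x - \<tau> * y x) x
          = ennreal (\<bar>g x + \<tau> * y x\<bar> + \<bar>g x - \<tau> * y x\<bar>)"
        using 2 elim(2) by simp
      also have "\<dots> \<le> ennreal (2 * (\<bar>g x\<bar> + \<tau> * \<bar>y x\<bar>))"
        using abs_triangle_ineq[of "g x" "\<tau> * y x"] abs_triangle_ineq4[of "g x" "\<tau> * y x"] \<tau>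
        by (intro ennreal_leI) (simp add: abs_mult)
      also have "\<dots> = 2 * (ennreal \<bar>g x\<bar> + ennreal \<tau> * ennreal \<bar>y x\<bar>)"
        using \<tau> by (simp add: ennreal_mult)
      also have "\<dots> = 2 * (?F g x + ennreal \<tau> * ?F ?yE x)"
        using 2 elim(2) by (simp add: endpoint_set_def)
      also have "\<dots> \<le> 2 * (?F g x + ennreal \<tau> * ?F ?yE x + C * (?I x + ennreal (\<tau>\<^sup>2) * ?F g x))"
        by (intro mult_left_mono) simp_all
      finally show ?thesis .
    next
      case 3
      then have "x \<notin> endpoint_set" by (auto simp: endpoint_set_def)
      define q where "q = enn2real (p x)"
      have q: "1 \<le> q" "q \<le> P" using real_exponent_gt_1[OF 3] elim(1) 3 by (auto simp: q_def)
      have "?F (\<lambda>x. g x + \<tau> * y x) x + ?F (\<lambda>x. g x - \<tau> * y x) x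
          = ennreal (\<bar>g x + \<tau> * y x\<bar> powr q + \<bar>g x - \<tau> * y x\<bar> powr q)"
        using 3 elim(2) by (simp add: q_def)
      also have "\<dots> \<le> ennreal (2 * (\<bar>g x\<bar> powr q + (1 + P\<^sup>2 * exp P)
          * (\<tau> powr min q 2 * \<bar>y x\<bar> powr q + \<tau>\<^sup>2 * \<bar>g x\<bar> powr q)))"
        by (intro ennreal_leI abs_powr_smooth_le q \<tau>)
      also have "\<dots> = 2 * (ennreal (\<bar>g x\<bar> powr q) + C
          * (ennreal (\<tau> powr min q 2 * \<bar>y x\<bar> powr q) + ennreal (\<tau>\<^sup>2) * ennreal (\<bar>g x\<bar> powr q)))"
        using \<tau> by (simp add: ennreal_mult C_def)
      also have "\<dots> = 2 * (?F g x + ennreal \<tau> * ?F ?yE x + C * (?I x + ennreal (\<tau>\<^sup>2) * ?F g x))"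
        using 3 elim(2) \<open>x \<notin> endpoint_set\<close> by (simp add: q_def)
      finally show ?thesis by simp
    qed
  qed
  also have "\<dots> = 2 * (finite_modular g + ennreal \<tau> * finite_modular ?yE
      + C * (intermediate_modular \<tau> y + ennreal (\<tau>\<^sup>2) * finite_modular g))"
    unfolding finite_modular_def intermediate_modular_def
    by (simp add: nn_integral_add nn_integral_cmult)
  also have "\<dots> \<le> 2 * (finite_modular g + ennreal \<tau> * finite_modular ?yE
      + C * (intermediate_modular \<tau> y + ennreal (\<tau>\<^sup>2) * modular M p g))"
    by (intro mult_left_mono add_mono) (auto simp: modular_eq)
  finally have fin: "finite_modular (\<lambda>x. g x + \<tau> * y x) + finite_modular (\<lambda>x. g x - \<tau> * y x) \<le> \<dots>" .
  have top_y: "top_modular y \<le> top_modular ?yE"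
    by (intro top_modular_mono) (auto simp: endpoint_set_def intro!: AE_I2)
  have "top_modular (\<lambda>x. g x + \<tau> * y x) \<le> top_modular g + ennreal \<tau> * top_modular ?yE"
    "top_modular (\<lambda>x. g x - \<tau> * y x) \<le> top_modular g + ennreal \<tau> * top_modular ?yE"
    using top_modular_sublinear[OF gy, of 1 \<tau>] top_modular_sublinear[OF gy, of 1 "- \<tau>"] \<tau>
      mult_left_mono[OF top_y, of "ennreal \<tau>"]
    by (auto intro: order_trans add_left_mono)
  from add_mono[OF this] have top: "top_modular (\<lambda>x. g x + \<tau> * y x) + top_modular (\<lambda>x. g x - \<tau> * y x)
      \<le> 2 * (top_modular g + ennreal \<tau> * top_modular ?yE)"
    by (simp add: mult_2 distrib_left ac_simps)
  from add_mono[OF fin top] show ?thesis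
    unfolding modular_eq[of "\<lambda>x. g x + \<tau> * y x"] modular_eq[of "\<lambda>x. g x - \<tau> * y x"] modular_eq[of ?yE]
    by (simp add: modular_eq[of g] distrib_left ac_simps)
qed

text \<open>After division by \<open>\<tau>\<close> the integrand is \<open>\<tau>\<^sup>m\<^sup>-\<^sup>1 \<bar>y\<bar>\<^sup>p\<close> with \<open>m = min p 2 > 1\<close>. It tends to \<open>0\<close> pointwise and is
  dominated by \<open>\<bar>y\<bar>\<^sup>p\<close>, although the exponent \<open>m - 1\<close> may have infimum \<open>0\<close>.\<close>

lemma intermediate_modular_small:
  assumes [measurable]: "y \<in> borel_measurable M" and fin: "modular M p y < \<infinity>" and e: "0 < e"
  shows "eventually (\<lambda>n. intermediate_modular (1 / real (Suc n)) y \<le> ennreal (1 / real (Suc n)) * ennreal e) sequentially"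
proof -
  let ?G = "{x \<in> space M. 1 < p x \<and> p x < \<infinity>}"
  define u where "u n x = ennreal ((1 / real (Suc n)) powr (min (enn2real (p x)) 2 - 1) * \<bar>y x\<bar> powr enn2real (p x))
    * indicator ?G x" for n x
  have [measurable]: "u n \<in> borel_measurable M" for n unfolding u_def by measurable
  have "(\<lambda>n. \<integral>\<^sup>+ x. u n x \<partial>M) \<longlonglongrightarrow> (\<integral>\<^sup>+ x. 0 \<partial>M)"
  proof (rule nn_integral_dominated_convergence)
    let ?w = "\<lambda>x. ennreal (\<bar>y x\<bar> powr enn2real (p x)) * indicator {x \<in> space M. p x < \<infinity>} x"
    show "(\<integral>\<^sup>+ x. ?w x \<partial>M) < \<infinity>"
      using fin by (simp add: modular_eq finite_modular_def)
    show "AE x in M. u n x \<le> ?w x" for n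
    proof (rule AE_I2)
      fix x assume x: "x \<in> space M"
      show "u n x \<le> ?w x"
      proof (cases "x \<in> ?G")
        case True
        then have "1 < enn2real (p x)" using real_exponent_gt_1 by blast
        then have "(1 / real (Suc n)) powr (min (enn2real (p x)) 2 - 1) \<le> 1 powr (min (enn2real (p x)) 2 - 1)"
          by (intro powr_mono2) auto
        then have "(1 / real (Suc n)) powr (min (enn2real (p x)) 2 - 1) * \<bar>y x\<bar> powr enn2real (p x) \<le> 1 * \<bar>y x\<bar> powr enn2real (p x)"
          by (intro mult_right_mono) auto
        then show ?thesis using True by (auto simp: u_def intro!: ennreal_leI)
      qed (simp add: u_def)
    qed
    show "AE x in M. (\<lambda>n. u n x) \<longlonglongrightarrow> 0"
    proof (rule AE_I2)
      fix x assume x: "x \<in> space M"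
      show "(\<lambda>n. u n x) \<longlonglongrightarrow> 0"
      proof (cases "x \<in> ?G")
        case True
        then have "1 < enn2real (p x)" using real_exponent_gt_1 by blast
        then have "(\<lambda>n. (1 / real (Suc n)) powr (min (enn2real (p x)) 2 - 1)) \<longlonglongrightarrow> 0 powr (min (enn2real (p x)) 2 - 1)"
          using lim_inverse_n' LIMSEQ_Suc[OF lim_inverse_n']
          by (intro tendsto_powr') auto
        then have "(\<lambda>n. (1 / real (Suc n)) powr (min (enn2real (p x)) 2 - 1) * \<bar>y x\<bar> powr enn2real (p x)) \<longlonglongrightarrow> 0"
          by (intro tendsto_mult_left_zero) simp
        then have "(\<lambda>n. ennreal ((1 / real (Suc n)) powr (min (enn2real (p x)) 2 - 1) * \<bar>y x\<bar> powr enn2real (p x))) \<longlonglongrightarrow> ennreal 0"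
          by (rule tendsto_ennrealI)
        then show ?thesis using True by (simp add: u_def)
      qed (simp add: u_def)
    qed
  qed auto
  then have "eventually (\<lambda>n. (\<integral>\<^sup>+ x. u n x \<partial>M) < ennreal e) sequentially"
    using e by (intro order_tendstoD) auto
  then show ?thesis
  proof eventually_elim
    case (elim n)
    let ?t = "1 / real (Suc n)"
    have "intermediate_modular ?t y = (\<integral>\<^sup>+ x. ennreal ?t * u n x \<partial>M)"
      unfolding intermediate_modular_def
    proof (intro nn_integral_cong)
      fix x
      let ?q = "min (enn2real (p x)) 2"
      have "?t powr ?q = ?t * ?t powr (?q - 1)"
        using powr_add[of ?t 1 "?q - 1"] by simp
      then have "ennreal (?t powr ?q * \<bar>y x\<bar> powr enn2real (p x))
          = ennreal ?t * ennreal (?t powr (?q - 1) * \<bar>y x\<bar> powr enn2real (p x))"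
        by (simp only: mult.assoc) (rule ennreal_mult, simp_all)
      then show "ennreal (?t powr ?q * \<bar>y x\<bar> powr enn2real (p x)) * indicator ?G x = ennreal ?t * u n x"
        unfolding u_def by (simp only: mult.assoc)
    qed
    also have "\<dots> = ennreal ?t * (\<integral>\<^sup>+ x. u n x \<partial>M)"
      by (intro nn_integral_cmult) measurable
    also have "\<dots> \<le> ennreal ?t * ennreal e"
      using elim by (intro mult_left_mono) auto
    finally show ?case .
  qed
qed

end

section \<open>Isometric copies are asymptotically isometric\<close>

lemma ell1_simps [simp]:
  "vecs ell1 = {t. summable (\<lambda>n. \<bar>t n\<bar>)}"
  "vadd ell1 s t = (\<lambda>n. s n + t n)"
  "vscale ell1 c t = (\<lambda>n. c * t n)"
  "vnorm ell1 t = (\<Sum>n. \<bar>t n\<bar>)"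
  by (simp_all add: ell1_def)

lemma summable_abs_truncation: "summable (\<lambda>n. \<bar>if n < N then t n else 0 :: real\<bar>)"
  by (rule summable_finite[of "{..<N}"]) auto

lemma ell1_truncation_error:
  fixes t :: "nat \<Rightarrow> real"
  assumes "summable (\<lambda>n. \<bar>t n\<bar>)"
  shows "(\<lambda>N. \<Sum>n. \<bar>(if n < N then t n else 0) + - 1 * t n\<bar>) \<longlonglongrightarrow> 0"
proof -
  have "(\<Sum>n. \<bar>(if n < N then t n else 0) + - 1 * t n\<bar>) = (\<Sum>n. \<bar>t n\<bar>) - (\<Sum>n<N. \<bar>t n\<bar>)" for N
  proof (rule sums_unique[symmetric])
    have "(\<lambda>n. if n \<in> {..<N} then \<bar>t n\<bar> else 0) sums (\<Sum>n<N. \<bar>t n\<bar>)"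
      by (rule sums_If_finite_set) simp
    from sums_diff[OF summable_sums[OF assms] this]
    show "(\<lambda>n. \<bar>(if n < N then t n else 0) + - 1 * t n\<bar>) sums ((\<Sum>n. \<bar>t n\<bar>) - (\<Sum>n<N. \<bar>t n\<bar>))"
      by (rule sums_cong[THEN iffD1, rotated]) auto
  qed
  moreover have "(\<lambda>N. (\<Sum>n. \<bar>t n\<bar>) - (\<Sum>n<N. \<bar>t n\<bar>)) \<longlonglongrightarrow> (\<Sum>n. \<bar>t n\<bar>) - (\<Sum>n. \<bar>t n\<bar>)"
    using assms by (intro tendsto_intros summable_LIMSEQ)
  ultimately show ?thesis by simp
qed

text \<open>The images of the unit vectors form the required sequence, and any null sequence in \<open>(0, 1)\<close> serves
  as \<open>\<epsilon>\<close>. The hypothesis on \<open>X\<close> identifies the empty sum with the image of \<open>0\<close>.\<close>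

lemma asymptotically_isometric_copy_of_isometric_copy:
  assumes zero: "\<And>v. v \<in> vecs X \<Longrightarrow> vscale X 0 v = vzero X"
    and "contains_isometric_copy_ell1 X"
  shows "contains_asymptotically_isometric_copy_ell1 X"
proof -
  obtain T where T: "linear_isometric_embedding ell1 X T"
    using assms(2) by (auto simp: contains_isometric_copy_ell1_def)
  have T_in: "T t \<in> vecs X" and T_scale: "T (\<lambda>n. c * t n) = vscale X c (T t)"
    and T_norm: "vnorm X (T t) = (\<Sum>n. \<bar>t n\<bar>)" if "summable (\<lambda>n. \<bar>t n\<bar>)" for t c
    using T that by (simp_all add: linear_isometric_embedding_def)
  have T_add: "T (\<lambda>n. s n + t n) = vadd X (T s) (T t)"
    if "summable (\<lambda>n. \<bar>s n\<bar>)" "summable (\<lambda>n. \<bar>t n\<bar>)" for s t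
    using T that by (simp add: linear_isometric_embedding_def)
  define e :: "nat \<Rightarrow> nat \<Rightarrow> real" where "e n = (\<lambda>k. if k = n then 1 else 0)" for n
  have e: "summable (\<lambda>k. \<bar>e n k\<bar>)" for n
    by (rule summable_finite[of "{n}"]) (auto simp: e_def)
  have partial: "vsum_lessThan X (\<lambda>n. vscale X (t n) (T (e n))) N = T (\<lambda>k. if k < N then t k else 0)" for t N
  proof (induction N)
    case 0
    show ?case using zero[OF T_in[of "\<lambda>_. 0"]] T_scale[of "\<lambda>_. 0" 0] by simp
  next
    case (Suc N)
    have "vadd X (T (\<lambda>k. if k < N then t k else 0)) (vscale X (t N) (T (e N)))
        = T (\<lambda>k. (if k < N then t k else 0) + t N * e N k)"
      using T_add[OF summable_abs_truncation, of "\<lambda>k. t N * e N k"] T_scale[OF e] summable_mult[OF e]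
      by (simp add: abs_mult)
    also have "(\<lambda>k. (if k < N then t k else 0) + t N * e N k) = (\<lambda>k. if k < Suc N then t k else 0)"
      by (auto simp: e_def fun_eq_iff less_Suc_eq)
    finally show ?case using Suc by simp
  qed
  show ?thesis
    unfolding contains_asymptotically_isometric_copy_ell1_def
  proof (intro exI conjI allI ballI)
    show "T (e n) \<in> vecs X" for n using T_in[OF e] .
    show "0 < 1 / (real n + 2)" "1 / (real n + 2) < 1" for n by auto
    show "(\<lambda>n. 1 / (real n + 2)) \<longlonglongrightarrow> 0"
      using LIMSEQ_ignore_initial_segment[OF lim_1_over_n, of 2] by (simp add: add.commute)
  next
    fix t :: "nat \<Rightarrow> real" assume "t \<in> vecs ell1"
    then have t: "summable (\<lambda>n. \<bar>t n\<bar>)" by simp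
    have le: "(1 - 1 / (real n + 2)) * \<bar>t n\<bar> \<le> \<bar>t n\<bar>" for n
      by (intro mult_left_le_one_le) auto
    show "vsums X (\<lambda>n. vscale X (t n) (T (e n))) (T t)"
      unfolding vsums_def partial
    proof
      have "vnorm X (vadd X (T (\<lambda>k. if k < N then t k else 0)) (vscale X (- 1) (T t)))
          = (\<Sum>n. \<bar>(if n < N then t n else 0) + - 1 * t n\<bar>)" for N
      proof -
        let ?u = "\<lambda>n. (if n < N then t n else 0) + - 1 * t n"
        have "summable (\<lambda>n. \<bar>?u n\<bar>)"
          by (rule summable_comparison_test'[OF t, of 0]) simp
        moreover have "T ?u = vadd X (T (\<lambda>k. if k < N then t k else 0)) (vscale X (- 1) (T t))"
          unfolding T_scale[OF t, symmetric] by (rule T_add[OF summable_abs_truncation]) (simp add: t)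
        ultimately show ?thesis by (metis T_norm)
      qed
      then show "(\<lambda>N. vnorm X (vadd X (T (\<lambda>k. if k < N then t k else 0)) (vscale X (- 1) (T t)))) \<longlonglongrightarrow> 0"
        using ell1_truncation_error[OF t] by simp
    qed (rule T_in[OF t])
    show "(\<Sum>n. (1 - 1 / (real n + 2)) * \<bar>t n\<bar>) \<le> vnorm X (T t)"
      unfolding T_norm[OF t]
    proof (intro suminf_le le t)
      show "summable (\<lambda>n. (1 - 1 / (real n + 2)) * \<bar>t n\<bar>)"
        by (rule summable_comparison_test'[OF t, of 0]) (use le in \<open>auto simp: abs_mult\<close>)
    qed
    show "vnorm X (T t) \<le> (\<Sum>n. \<bar>t n\<bar>)" by (simp add: T_norm[OF t])
  qed
qed

section \<open>A norming sequence of functionals on the space of summable sequences\<close>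

text \<open>The coefficients are \<open>+1\<close> on the finite set coded by the first component of \<open>n\<close> and \<open>-1\<close> elsewhere.
  Decoding \<open>n\<close> as a pair makes every sign pattern occur for infinitely many \<open>n\<close>.\<close>

definition sign_functional :: "nat \<Rightarrow> (nat \<Rightarrow> real) \<Rightarrow> real" where
  "sign_functional n t = (\<Sum>m. (if m \<in> set_decode (fst (prod_decode n)) then 1 else - 1) * t m)"

lemma summable_signed:
  fixes t :: "nat \<Rightarrow> real"
  assumes "summable (\<lambda>n. \<bar>t n\<bar>)"
  shows "summable (\<lambda>m. (if m \<in> S then 1 else - 1) * t m)"
  by (rule summable_comparison_test'[OF assms, of 0]) (simp add: abs_mult)

lemma sign_functional_add:
  assumes "summable (\<lambda>n. \<bar>s n\<bar>)" "summable (\<lambda>n. \<bar>t n\<bar>)"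
  shows "sign_functional n (\<lambda>m. s m + t m) = sign_functional n s + sign_functional n t"
  unfolding sign_functional_def distrib_left
  by (rule suminf_add[symmetric]) (intro summable_signed assms)+

lemma sign_functional_scale:
  assumes "summable (\<lambda>n. \<bar>t n\<bar>)"
  shows "sign_functional n (\<lambda>m. c * t m) = c * sign_functional n t"
  unfolding sign_functional_def
  by (subst suminf_mult[OF summable_signed[OF assms], symmetric]) (simp only: mult.left_commute)

lemma abs_sign_functional_le:
  assumes "summable (\<lambda>n. \<bar>t n\<bar>)"
  shows "\<bar>sign_functional n t\<bar> \<le> (\<Sum>n. \<bar>t n\<bar>)"
proof -
  have eq: "\<bar>(if m \<in> set_decode (fst (prod_decode n)) then 1 else - 1) * t m\<bar> = \<bar>t m\<bar>" for m
    by simp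
  show ?thesis
    using summable_rabs[of "\<lambda>m. (if m \<in> set_decode (fst (prod_decode n)) then 1 else - 1) * t m"] assms
    unfolding sign_functional_def eq by blast
qed

text \<open>The signs of \<open>t\<close> on a long initial segment reproduce its norm up to twice the tail.\<close>

lemma sign_functional_norming:
  assumes t: "summable (\<lambda>n. \<bar>t n\<bar>)" and c: "c < (\<Sum>n. \<bar>t n\<bar>)"
  shows "\<exists>\<^sub>F n in sequentially. c < sign_functional n t"
proof -
  have "(\<lambda>K. 2 * (\<Sum>m<K. \<bar>t m\<bar>) - (\<Sum>m. \<bar>t m\<bar>)) \<longlonglongrightarrow> 2 * (\<Sum>m. \<bar>t m\<bar>) - (\<Sum>m. \<bar>t m\<bar>)"
    using t by (intro tendsto_intros summable_LIMSEQ)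
  then have "eventually (\<lambda>K. c < 2 * (\<Sum>m<K. \<bar>t m\<bar>) - (\<Sum>m. \<bar>t m\<bar>)) sequentially"
    using c by (intro order_tendstoD) auto
  then obtain K where K: "c < 2 * (\<Sum>m<K. \<bar>t m\<bar>) - (\<Sum>m. \<bar>t m\<bar>)"
    by (auto simp: eventually_sequentially)
  define S where "S = {m. m < K \<and> 0 \<le> t m}"
  have S: "finite S" by (simp add: S_def)
  have large: "c < sign_functional (prod_encode (set_encode S, k)) t" for k
  proof -
    have "(\<lambda>m. if m \<in> {..<K} then \<bar>t m\<bar> else 0) sums (\<Sum>m<K. \<bar>t m\<bar>)"
      by (rule sums_If_finite_set) simp
    from sums_diff[OF sums_mult[OF this, of 2] summable_sums[OF t]]
    have sums: "(\<lambda>m. 2 * (if m \<in> {..<K} then \<bar>t m\<bar> else 0) - \<bar>t m\<bar>) sums (2 * (\<Sum>m<K. \<bar>t m\<bar>) - (\<Sum>m. \<bar>t m\<bar>))" .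
    have "2 * (\<Sum>m<K. \<bar>t m\<bar>) - (\<Sum>m. \<bar>t m\<bar>) \<le> (\<Sum>m. (if m \<in> S then 1 else - 1) * t m)"
      by (rule sums_le[OF _ sums summable_sums[OF summable_signed[OF t]]]) (auto simp: S_def)
    with K S show ?thesis by (simp add: sign_functional_def set_encode_inverse)
  qed
  show ?thesis
    unfolding frequently_sequentially
  proof (intro allI exI conjI)
    show "k \<le> prod_encode (set_encode S, k)" for k by (rule le_prod_encode_2)
    show "c < sign_functional (prod_encode (set_encode S, k)) t" for k by (rule large)
  qed
qed

section \<open>Disjoint families of sets\<close>

text \<open>A measurable index function makes functions that are constant on each member of a disjoint family
  measurable by composition, and linear in the constants by definition.\<close>

lemma disjoint_family_index:
  fixes D :: "nat \<Rightarrow> 'a set"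
  assumes disj: "disjoint_family D" and [measurable]: "\<And>n. D n \<in> sets M"
  obtains ix where "ix \<in> measurable M (count_space UNIV)" "\<And>x n. x \<in> D n \<Longrightarrow> ix x = n"
proof
  show "(\<lambda>x. LEAST n. x \<in> D n) \<in> measurable M (count_space UNIV)" by measurable
  fix x n assume "x \<in> D n"
  then have "n \<le> m" if "x \<in> D m" for m
    using disj that by (cases "m = n") (auto simp: disjoint_family_on_def)
  with \<open>x \<in> D n\<close> show "(LEAST n. x \<in> D n) = n"
    by (rule Least_equality)
qed

lemma nn_integral_disjoint_steps:
  assumes A [measurable]: "\<And>n. A n \<in> sets M"
    and fin: "\<And>n. 0 < emeasure M (A n)" "\<And>n. emeasure M (A n) < \<infinity>" and c: "\<And>n. 0 \<le> c n"
  shows "(\<integral>\<^sup>+ x. (\<Sum>n. ennreal (c n / measure M (A n)) * indicator (A n) x) \<partial>M) = (\<Sum>n. ennreal (c n))"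
proof -
  have "ennreal (c n / measure M (A n)) * emeasure M (A n) = ennreal (c n)" for n
  proof -
    have em: "emeasure M (A n) = ennreal (measure M (A n))"
      using fin(2)[of n] by (intro emeasure_eq_ennreal_measure) auto
    then have "0 < measure M (A n)" using fin(1)[of n] by simp
    then show ?thesis using c[of n] by (simp add: em flip: ennreal_mult)
  qed
  then show ?thesis by (simp add: nn_integral_suminf nn_integral_cmult)
qed

lemma (in sigma_finite_measure) nonnull_finite_subset:
  assumes B: "B \<in> sets M" "B \<notin> null_sets M"
  obtains C where "C \<in> sets M" "C \<subseteq> B" "0 < emeasure M C" "emeasure M C < \<infinity>"
proof -
  obtain A :: "nat \<Rightarrow> 'a set" where A: "range A \<subseteq> sets M" "(\<Union>i. A i) = space M" "\<And>i. emeasure M (A i) \<noteq> \<infinity>"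
    using sigma_finite by blast
  have "\<exists>i. B \<inter> A i \<notin> null_sets M"
  proof (rule ccontr)
    assume "\<nexists>i. B \<inter> A i \<notin> null_sets M"
    then have "(\<Union>i. B \<inter> A i) \<in> null_sets M" by (intro null_sets_UN) auto
    moreover have "(\<Union>i. B \<inter> A i) = B" using A(2) sets.sets_into_space[OF B(1)] by auto
    ultimately show False using B by simp
  qed
  then obtain i where i: "B \<inter> A i \<notin> null_sets M" by blast
  have sets: "B \<inter> A i \<in> sets M" using A(1) B by auto
  show thesis
  proof (rule that)
    show "0 < emeasure M (B \<inter> A i)" using i sets by (simp add: null_sets_def zero_less_iff_neq_zero)
    have "emeasure M (B \<inter> A i) \<le> emeasure M (A i)" using A(1) by (intro emeasure_mono) auto
    then show "emeasure M (B \<inter> A i) < \<infinity>" using A(3)[of i] by (auto simp: less_top top_unique)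
  qed (use sets in auto)
qed

section \<open>Isometric copies from disjoint sets\<close>

context variable_exponent
begin

lemma luxemburg_eqI:
  assumes g: "g \<in> var_Lebesgue_fun M p" and c: "0 \<le> c"
    and above: "\<And>a. c < a \<Longrightarrow> modular M p (\<lambda>x. g x / a) \<le> 1"
    and below: "\<And>a. 0 < a \<Longrightarrow> a < c \<Longrightarrow> \<not> modular M p (\<lambda>x. g x / a) \<le> 1"
  shows "luxemburg M p g = c"
proof (rule antisym)
  show "luxemburg M p g \<le> c"
    by (rule dense_ge) (use c above in \<open>auto intro: luxemburg_le\<close>)
  show "c \<le> luxemburg M p g"
  proof (rule ccontr)
    assume "\<not> c \<le> luxemburg M p g"
    then obtain a where "luxemburg M p g < a" "a < c" using dense by (metis not_le)
    then show False
      using below[of a] modular_le_1_of_luxemburg_less[OF g] luxemburg_nonneg[OF g] by fastforce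
  qed
qed

lemma isometric_copy_ell1I:
  fixes \<Phi> :: "(nat \<Rightarrow> real) \<Rightarrow> 'a \<Rightarrow> real"
  assumes meas [measurable]: "\<And>t. \<Phi> t \<in> borel_measurable M"
    and add: "\<And>s t x. summable (\<lambda>n. \<bar>s n\<bar>) \<Longrightarrow> summable (\<lambda>n. \<bar>t n\<bar>) \<Longrightarrow>
      \<Phi> (\<lambda>n. s n + t n) x = \<Phi> s x + \<Phi> t x"
    and scale: "\<And>c t x. summable (\<lambda>n. \<bar>t n\<bar>) \<Longrightarrow> \<Phi> (\<lambda>n. c * t n) x = c * \<Phi> t x"
    and above: "\<And>t a. summable (\<lambda>n. \<bar>t n\<bar>) \<Longrightarrow> (\<Sum>n. \<bar>t n\<bar>) < a \<Longrightarrow> modular M p (\<lambda>x. \<Phi> t x / a) \<le> 1"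
    and below: "\<And>t a. summable (\<lambda>n. \<bar>t n\<bar>) \<Longrightarrow> 0 < a \<Longrightarrow> a < (\<Sum>n. \<bar>t n\<bar>) \<Longrightarrow>
      \<not> modular M p (\<lambda>x. \<Phi> t x / a) \<le> 1"
  shows "contains_isometric_copy_ell1 (var_Lebesgue M p)"
proof -
  let ?X = "var_Lebesgue M p"
  let ?T = "\<lambda>t. AE_class M (\<Phi> t)"
  have mem: "\<Phi> t \<in> var_Lebesgue_fun M p" if "summable (\<lambda>n. \<bar>t n\<bar>)" for t
    using above[OF that, of "(\<Sum>n. \<bar>t n\<bar>) + 1"] suminf_nonneg[OF that]
    by (auto simp: var_Lebesgue_fun_def intro!: exI[of _ "(\<Sum>n. \<bar>t n\<bar>) + 1"] elim: le_less_trans)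
  have "linear_isometric_embedding ell1 ?X ?T"
    unfolding linear_isometric_embedding_def
  proof (intro conjI ballI allI)
    fix t assume "t \<in> vecs ell1"
    then have t: "summable (\<lambda>n. \<bar>t n\<bar>)" by simp
    show "?T t \<in> vecs ?X" using mem[OF t] by (simp add: var_Lebesgue_def)
    show "vnorm ?X (?T t) = vnorm ell1 t"
      using luxemburg_eqI[OF mem[OF t], of "\<Sum>n. \<bar>t n\<bar>"] above[OF t] below[OF t] suminf_nonneg[OF t]
      by (simp add: AE_class_norm)
    have "\<Phi> (\<lambda>n. c * t n) = (\<lambda>x. c * \<Phi> t x)" for c
      using scale[OF t] by (rule ext)
    then show "?T (vscale ell1 c t) = vscale ?X c (?T t)" for c
      by (simp add: AE_class_scale)
    fix s assume "s \<in> vecs ell1"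
    then have s: "summable (\<lambda>n. \<bar>s n\<bar>)" by simp
    have "\<Phi> (\<lambda>n. t n + s n) = (\<lambda>x. \<Phi> t x + \<Phi> s x)"
      using add[OF t s] by (rule ext)
    then show "?T (vadd ell1 t s) = vadd ?X (?T t) (?T s)"
      by (simp add: AE_class_add)
  qed
  then show ?thesis by (auto simp: contains_isometric_copy_ell1_def)
qed

text \<open>The pieces of \<open>f\<close> on the sets \<open>ix = n\<close> behave as the unit vectors of the supremum norm: together they
  have norm at most \<open>1\<close>, and the norms of the single pieces are eventually at least \<open>1 / l\<close> for each \<open>l > 1\<close>.
  As no single piece has to have norm \<open>1\<close>, the functionals must take large values infinitely often,
  as in \<open>sign_functional_norming\<close>.\<close>

lemma isometric_copy_ell1_of_sup_system:
  assumes ix [measurable]: "ix \<in> measurable M (count_space UNIV)"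
    and f [measurable]: "f \<in> borel_measurable M" and f_le: "modular M p f \<le> 1"
    and large: "\<And>l. 1 < l \<Longrightarrow>
      eventually (\<lambda>n. 1 < modular M p (\<lambda>x. l * (f x * indicator {x \<in> space M. ix x = n} x))) sequentially"
  shows "contains_isometric_copy_ell1 (var_Lebesgue M p)"
proof (rule isometric_copy_ell1I)
  let ?\<Phi> = "\<lambda>t x. sign_functional (ix x) t * f x"
  show [measurable]: "?\<Phi> t \<in> borel_measurable M" for t
    by (intro borel_measurable_times f measurable_compose[OF ix]) simp
  show "?\<Phi> (\<lambda>n. s n + t n) x = ?\<Phi> s x + ?\<Phi> t x"
    if "summable (\<lambda>n. \<bar>s n\<bar>)" "summable (\<lambda>n. \<bar>t n\<bar>)" for s t x
    using sign_functional_add[OF that] by (simp add: distrib_right)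
  fix t :: "nat \<Rightarrow> real" assume t: "summable (\<lambda>n. \<bar>t n\<bar>)"
  show "?\<Phi> (\<lambda>n. c * t n) x = c * ?\<Phi> t x" for c x
    using sign_functional_scale[OF t] by simp
  fix a :: real
  show "modular M p (\<lambda>x. ?\<Phi> t x / a) \<le> 1" if a: "(\<Sum>n. \<bar>t n\<bar>) < a"
  proof -
    have "\<bar>?\<Phi> t x / a\<bar> \<le> \<bar>f x\<bar>" for x
    proof -
      have "\<bar>sign_functional (ix x) t\<bar> \<le> a" using abs_sign_functional_le[OF t, of "ix x"] a by simp
      moreover have "0 < a" using suminf_nonneg[OF t] a by simp
      ultimately have "\<bar>sign_functional (ix x) t\<bar> / a * \<bar>f x\<bar> \<le> 1 * \<bar>f x\<bar>"
        by (intro mult_right_mono) auto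
      then show ?thesis using \<open>0 < a\<close> by (simp add: abs_mult)
    qed
    then have "modular M p (\<lambda>x. ?\<Phi> t x / a) \<le> modular M p f"
      by (intro modular_mono) auto
    with f_le show ?thesis by simp
  qed
  show "\<not> modular M p (\<lambda>x. ?\<Phi> t x / a) \<le> 1" if a: "0 < a" "a < (\<Sum>n. \<bar>t n\<bar>)"
  proof -
    obtain c where c: "a < c" "c < (\<Sum>n. \<bar>t n\<bar>)" using dense[OF a(2)] by blast
    have "1 < c / a" using a c by simp
    from frequently_eventually_conj[OF sign_functional_norming[OF t c(2)] large[OF this]]
    obtain n where n: "c < sign_functional n t"
      "1 < modular M p (\<lambda>x. c / a * (f x * indicator {x \<in> space M. ix x = n} x))"
      by (auto dest!: frequently_ex)
    have "modular M p (\<lambda>x. c / a * (f x * indicator {x \<in> space M. ix x = n} x)) \<le> modular M p (\<lambda>x. ?\<Phi> t x / a)"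
    proof (intro modular_mono AE_I2)
      fix x
      have "c * \<bar>f x\<bar> \<le> \<bar>sign_functional n t\<bar> * \<bar>f x\<bar>"
        using n(1) by (intro mult_right_mono) auto
      then show "\<bar>c / a * (f x * indicator {x \<in> space M. ix x = n} x)\<bar> \<le> \<bar>?\<Phi> t x / a\<bar>"
        using a c by (auto simp: abs_mult divide_simps split: split_indicator)
    qed measurable
    with n(2) show ?thesis by simp
  qed
qed

lemma isometric_copy_ell1_of_top_exponent:
  assumes "\<not> precompact_on {x \<in> space M. p x = \<infinity>}"
  shows "contains_isometric_copy_ell1 (var_Lebesgue M p)"
proof -
  have exponent_set: "{x \<in> space M. p x = \<infinity>} \<in> sets M" "{x \<in> space M. p x = \<infinity>} \<subseteq> endpoint_set"
    by (measurable, auto simp: endpoint_set_def)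
  obtain D :: "nat \<Rightarrow> 'a set" where D: "disjoint_family D" "\<And>n. D n \<in> sets M"
      "\<And>n. D n \<subseteq> {x \<in> space M. p x = \<infinity>}" "\<And>n. D n \<notin> null_sets M"
    by (rule disjoint_sequence_of_not_precompact[OF exponent_set assms]) (rule that)
  obtain ix where ix [measurable]: "ix \<in> measurable M (count_space UNIV)" and ix_eq: "\<And>x n. x \<in> D n \<Longrightarrow> ix x = n"
    by (rule disjoint_family_index[OF D(1,2)]) (rule that)
  define f :: "'a \<Rightarrow> real" where "f x = indicator {x \<in> space M. p x = \<infinity>} x" for x
  have f [measurable]: "f \<in> borel_measurable M" unfolding f_def by measurable
  show ?thesis
  proof (rule isometric_copy_ell1_of_sup_system[OF ix f])
    have "finite_modular f = 0"
      unfolding finite_modular_def f_def by (intro nn_integral_0_iff_AE[THEN iffD2] AE_I2)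
        (auto split: split_indicator)
    moreover have "top_modular f \<le> 1"
      by (subst top_modular_le_iff) (auto simp: f_def split: split_indicator)
    ultimately show "modular M p f \<le> 1" by (simp add: modular_eq)
    fix l :: real assume l: "1 < l"
    have "1 < modular M p (\<lambda>x. l * (f x * indicator {x \<in> space M. ix x = n} x))" for n
    proof (rule ccontr)
      assume "\<not> 1 < modular M p (\<lambda>x. l * (f x * indicator {x \<in> space M. ix x = n} x))"
      then have "top_modular (\<lambda>x. l * (f x * indicator {x \<in> space M. ix x = n} x)) \<le> 1"
        by (auto simp: modular_eq not_less intro: order_trans[rotated])
      then have "AE x in M. p x = \<infinity> \<longrightarrow> ennreal \<bar>l * (f x * indicator {x \<in> space M. ix x = n} x)\<bar> \<le> 1"
        by (subst (asm) top_modular_le_iff) measurable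
      then have "AE x in M. x \<notin> D n"
        using AE_space
      proof eventually_elim
        case (elim x)
        show ?case
        proof
          assume x: "x \<in> D n"
          then have "p x = \<infinity>" "ix x = n" using D(3) ix_eq by auto
          with elim l show False by (simp add: f_def)
        qed
      qed
      then show False using D(2,4) by (simp add: AE_iff_null_sets)
    qed
    then show "eventually (\<lambda>n. 1 < modular M p (\<lambda>x. l * (f x * indicator {x \<in> space M. ix x = n} x))) sequentially"
      by simp
  qed
qed

text \<open>A variable exponent makes it natural to prescribe \<open>\<bar>g\<bar>\<^sup>p\<close>, rather than \<open>g\<close>, as a constant on each
  piece; division by the measure of \<open>A n\<close> normalizes its integral there to \<open>c n\<close>.\<close>

lemma finite_modular_disjoint_steps:
  assumes A: "disjoint_family A" "\<And>n. A n \<in> sets M" "\<And>n. A n \<subseteq> {x \<in> space M. p x < \<infinity>}"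
    and fin: "\<And>n. 0 < emeasure M (A n)" "\<And>n. emeasure M (A n) < \<infinity>" and c: "\<And>n. 0 \<le> c n"
    and on: "\<And>n x. x \<in> A n \<Longrightarrow> \<bar>g x\<bar> powr enn2real (p x) = c n / measure M (A n)"
    and off: "\<And>x. \<forall>n. x \<notin> A n \<Longrightarrow> g x = 0"
  shows "finite_modular g = (\<Sum>n. ennreal (c n))"
proof -
  have "finite_modular g = (\<integral>\<^sup>+ x. (\<Sum>n. ennreal (c n / measure M (A n)) * indicator (A n) x) \<partial>M)"
    unfolding finite_modular_def
  proof (intro nn_integral_cong)
    fix x assume x: "x \<in> space M"
    show "ennreal (\<bar>g x\<bar> powr enn2real (p x)) * indicator {x \<in> space M. p x < \<infinity>} x
      = (\<Sum>n. ennreal (c n / measure M (A n)) * indicator (A n) x)"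
    proof (cases "\<exists>n. x \<in> A n")
      case True
      then obtain n where n: "x \<in> A n" by blast
      have "(\<Sum>n. ennreal (c n / measure M (A n)) * indicator (A n) x) = ennreal (c n / measure M (A n))"
        by (rule suminf_cmult_indicator[OF A(1) n])
      moreover have "x \<in> {x \<in> space M. p x < \<infinity>}" using n A(3) by blast
      ultimately show ?thesis using on[OF n] by simp
    next
      case False
      then show ?thesis using off[of x] by simp
    qed
  qed
  also have "\<dots> = (\<Sum>n. ennreal (c n))"
    by (intro nn_integral_disjoint_steps A fin c)
  finally show ?thesis .
qed

lemma top_modular_eq_0:
  assumes "g \<in> borel_measurable M" "\<And>x. p x = \<infinity> \<Longrightarrow> g x = 0"
  shows "top_modular g = 0"
  using top_modular_le_iff[OF assms(1), of 0] assms(2) by simp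

end

locale sigma_finite_variable_exponent = variable_exponent + sigma_finite_measure M
begin

lemma finite_measure_subsequence:
  assumes D: "disjoint_family D" "\<And>n :: nat. D n \<in> sets M" "\<And>n. D n \<notin> null_sets M"
  obtains A where "disjoint_family A" "\<And>n. A n \<in> sets M" "\<And>n. A n \<subseteq> D n"
    "\<And>n. 0 < emeasure M (A n)" "\<And>n. emeasure M (A n) < \<infinity>"
proof -
  have "\<exists>C. C \<in> sets M \<and> C \<subseteq> D n \<and> 0 < emeasure M C \<and> emeasure M C < \<infinity>" for n
    using nonnull_finite_subset[OF D(2,3), of n] by metis
  then obtain A where A: "\<And>n. A n \<in> sets M \<and> A n \<subseteq> D n \<and> 0 < emeasure M (A n) \<and> emeasure M (A n) < \<infinity>"
    by metis
  moreover have "disjoint_family A"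
    using D(1) A unfolding disjoint_family_on_def by blast
  ultimately show thesis using that by blast
qed

lemma isometric_copy_ell1_of_exponent_1:
  assumes "\<not> precompact_on {x \<in> space M. p x = 1}"
  shows "contains_isometric_copy_ell1 (var_Lebesgue M p)"
proof -
  have exponent_set: "{x \<in> space M. p x = 1} \<in> sets M" "{x \<in> space M. p x = 1} \<subseteq> endpoint_set"
    by (measurable, auto simp: endpoint_set_def)
  obtain D :: "nat \<Rightarrow> 'a set" where D: "disjoint_family D" "\<And>n. D n \<in> sets M"
      "\<And>n. D n \<subseteq> {x \<in> space M. p x = 1}" "\<And>n. D n \<notin> null_sets M"
    by (rule disjoint_sequence_of_not_precompact[OF exponent_set assms]) (rule that)
  obtain A :: "nat \<Rightarrow> 'a set" where A: "disjoint_family A" "\<And>n. A n \<in> sets M" "\<And>n. A n \<subseteq> D n"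
    "\<And>n. 0 < emeasure M (A n)" "\<And>n. emeasure M (A n) < \<infinity>"
    by (rule finite_measure_subsequence[OF D(1,2,4)]) (rule that)
  note [measurable] = A(2)
  have p1: "p x = 1" if "x \<in> A n" for x n using that A(3) D(3) by blast
  obtain ix where ix [measurable]: "ix \<in> measurable M (count_space UNIV)" and ix_eq: "\<And>x n. x \<in> A n \<Longrightarrow> ix x = n"
    by (rule disjoint_family_index[OF A(1,2)]) (rule that)
  define \<Phi> :: "(nat \<Rightarrow> real) \<Rightarrow> 'a \<Rightarrow> real"
    where "\<Phi> t x = t (ix x) * (indicator (\<Union>n. A n) x / measure M (A (ix x)))" for t x
  have meas [measurable]: "\<Phi> t \<in> borel_measurable M" for t
    unfolding \<Phi>_def by (intro borel_measurable_times borel_measurable_divide measurable_compose[OF ix]) simp_all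
  have modular: "modular M p (\<lambda>x. \<Phi> t x / a) = ennreal ((\<Sum>n. \<bar>t n\<bar>) / a)"
    if t: "summable (\<lambda>n. \<bar>t n\<bar>)" and a: "0 < a" for t a
  proof -
    have "finite_modular (\<lambda>x. \<Phi> t x / a) = (\<Sum>n. ennreal (\<bar>t n\<bar> / a))"
    proof (rule finite_modular_disjoint_steps[OF A(1,2) _ A(4,5)])
      show "A n \<subseteq> {x \<in> space M. p x < \<infinity>}" for n
        using p1 sets.sets_into_space[OF A(2)] by fastforce
      show "\<bar>\<Phi> t x / a\<bar> powr enn2real (p x) = \<bar>t n\<bar> / a / measure M (A n)" if x: "x \<in> A n" for n x
        using p1[OF x] ix_eq[OF x] x a by (auto simp: \<Phi>_def abs_mult mult.commute split: split_indicator)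
    qed (use a in \<open>auto simp: \<Phi>_def\<close>)
    also have "\<dots> = ennreal (\<Sum>n. \<bar>t n\<bar> / a)"
      using t a by (intro suminf_ennreal2 summable_divide) auto
    also have "(\<Sum>n. \<bar>t n\<bar> / a) = (\<Sum>n. \<bar>t n\<bar>) / a"
      by (rule suminf_divide[OF t])
    finally have "finite_modular (\<lambda>x. \<Phi> t x / a) = ennreal ((\<Sum>n. \<bar>t n\<bar>) / a)" .
    moreover have "top_modular (\<lambda>x. \<Phi> t x / a) = 0"
    proof (rule top_modular_eq_0)
      fix x assume "p x = \<infinity>"
      then have "x \<notin> (\<Union>n. A n)" using p1 by fastforce
      then show "\<Phi> t x / a = 0" by (simp add: \<Phi>_def)
    qed measurable
    ultimately show ?thesis by (simp add: modular_eq)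
  qed
  show ?thesis
  proof (rule isometric_copy_ell1I[of \<Phi>])
    fix t :: "nat \<Rightarrow> real" and a :: real assume t: "summable (\<lambda>n. \<bar>t n\<bar>)"
    show "modular M p (\<lambda>x. \<Phi> t x / a) \<le> 1" if "(\<Sum>n. \<bar>t n\<bar>) < a"
      using that suminf_nonneg[OF t] by (subst modular[OF t]) auto
    show "\<not> modular M p (\<lambda>x. \<Phi> t x / a) \<le> 1" if "0 < a" "a < (\<Sum>n. \<bar>t n\<bar>)"
      using that by (subst modular[OF t]) (auto simp: not_le)
  qed (simp_all add: \<Phi>_def distrib_right add_divide_distrib)
qed

text \<open>On disjoint sets \<open>A n\<close> with \<open>p \<ge> n\<^sup>2\<close>, let \<open>\<bar>f\<bar>\<^sup>p\<close> have integral \<open>2\<^sup>-\<^sup>n\<^sup>-\<^sup>1\<close> over \<open>A n\<close>. The modular of \<open>f\<close> is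
  then \<open>1\<close>, while multiplication of \<open>f\<close> by \<open>l > 1\<close> multiplies the integral over \<open>A n\<close> by at least
  \<open>l\<close> to the power \<open>n\<^sup>2\<close>, which beats the factor \<open>2\<^sup>-\<^sup>n\<^sup>-\<^sup>1\<close>.\<close>

lemma isometric_copy_ell1_of_unbounded_exponent:
  assumes unbounded: "\<nexists>P. AE x in M. p x < \<infinity> \<longrightarrow> enn2real (p x) \<le> P"
  shows "contains_isometric_copy_ell1 (var_Lebesgue M p)"
proof -
  define L where "L j = {x \<in> space M. p x < \<infinity> \<and> nat \<lfloor>enn2real (p x)\<rfloor> = j}" for j
  have L [measurable]: "L j \<in> sets M" for j unfolding L_def by measurable
  define J where "J = {j. L j \<notin> null_sets M}"
  have J: "infinite J"
  proof
    assume "finite J"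
    then obtain m where m: "\<And>j. j \<in> J \<Longrightarrow> j \<le> m" by (meson finite_nat_set_iff_bounded_le)
    have "AE x in M. x \<notin> L j" if "m < j" for j
      using m[of j] that by (intro AE_not_in) (auto simp: J_def)
    then have "AE x in M. \<forall>j. m < j \<longrightarrow> x \<notin> L j" by (simp add: AE_all_countable)
    then have "AE x in M. p x < \<infinity> \<longrightarrow> enn2real (p x) \<le> real m + 1"
      using AE_space
    proof eventually_elim
      case (elim x)
      show ?case
      proof
        assume "p x < \<infinity>"
        then have "x \<in> L (nat \<lfloor>enn2real (p x)\<rfloor>)" using elim by (simp add: L_def)
        then have "nat \<lfloor>enn2real (p x)\<rfloor> \<le> m" using elim by (meson not_le)
        then show "enn2real (p x) \<le> real m + 1" by linarith
      qed
    qed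
    with unbounded show False by blast
  qed
  \<comment> \<open>The element number \<open>n * n\<close> of \<open>J\<close> is at least \<open>n * n\<close>.\<close>
  define D where "D n = L (enumerate J (n * n))" for n
  have D_nonnull: "D n \<notin> null_sets M" for n
    using enumerate_in_set[OF J, of "n * n"] by (simp add: D_def J_def)
  have D_disjoint: "disjoint_family D"
    unfolding disjoint_family_on_def
  proof (intro ballI impI)
    fix m n :: nat assume "m \<noteq> n"
    then have "m * m \<noteq> n * n" by (simp add: power2_eq_square[symmetric])
    then have "enumerate J (m * m) \<noteq> enumerate J (n * n)"
      using enumerate_mono[OF _ J] by (metis nat_neq_iff)
    then show "D m \<inter> D n = {}" by (auto simp: D_def L_def)
  qed
  have D_sets: "D n \<in> sets M" for n by (simp add: D_def)
  obtain A :: "nat \<Rightarrow> 'a set" where A: "disjoint_family A" "\<And>n. A n \<in> sets M" "\<And>n. A n \<subseteq> D n"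
    "\<And>n. 0 < emeasure M (A n)" "\<And>n. emeasure M (A n) < \<infinity>"
    by (rule finite_measure_subsequence[OF D_disjoint D_sets D_nonnull]) (rule that)
  note [measurable] = A(2)
  have A_top: "p x < \<infinity>" and A_ge: "real (n * n) \<le> enn2real (p x)" if "x \<in> A n" for x n
  proof -
    have "x \<in> L (enumerate J (n * n))" using that A(3) by (auto simp: D_def)
    then have top: "p x < \<infinity>" and "nat \<lfloor>enn2real (p x)\<rfloor> = enumerate J (n * n)"
      unfolding L_def by auto
    then have "n * n \<le> nat \<lfloor>enn2real (p x)\<rfloor>" using le_enumerate[OF J, of "n * n"] by simp
    then have "int (n * n) \<le> \<lfloor>enn2real (p x)\<rfloor>" by (simp add: le_nat_iff del: of_nat_mult)
    then show "real (n * n) \<le> enn2real (p x)" by (simp add: le_floor_iff)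
    show "p x < \<infinity>" by fact
  qed
  have A_pos: "0 < measure M (A n)" for n
    using A(4,5)[of n] by (simp add: measure_def enn2real_positive_iff)
  obtain ix where ix [measurable]: "ix \<in> measurable M (count_space UNIV)" and ix_eq: "\<And>x n. x \<in> A n \<Longrightarrow> ix x = n"
    by (rule disjoint_family_index[OF A(1,2)]) (rule that)
  define w where "w n = (1 / 2 :: real) ^ Suc n" for n
  have w: "0 < w n" for n by (simp add: w_def)
  define f where "f x = indicator (\<Union>n. A n) x * (w (ix x) / measure M (A (ix x))) powr (1 / enn2real (p x))" for x
  have f [measurable]: "f \<in> borel_measurable M"
  proof -
    have [measurable]: "(\<lambda>x. w (ix x) / measure M (A (ix x))) \<in> borel_measurable M"
      by (intro measurable_compose[OF ix]) simp
    show ?thesis unfolding f_def by measurable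
  qed
  have f_powr: "\<bar>f x\<bar> powr enn2real (p x) = w n / measure M (A n)" if x: "x \<in> A n" for x n
  proof -
    have "1 \<le> enn2real (p x)"
      using real_exponent_ge_1 A_top[OF x] x sets.sets_into_space[OF A(2)] by blast
    moreover have "0 < w n / measure M (A n)" using A_pos w by simp
    moreover have "indicator (\<Union>n. A n) x = (1 :: real)" using x by (auto simp: indicator_def)
    ultimately show ?thesis using ix_eq[OF x] w[of n] by (simp add: f_def powr_powr)
  qed
  show ?thesis
  proof (rule isometric_copy_ell1_of_sup_system[OF ix f])
    have "finite_modular f = (\<Sum>n. ennreal (w n))"
    proof (rule finite_modular_disjoint_steps[OF A(1,2) _ A(4,5)])
      show "A n \<subseteq> {x \<in> space M. p x < \<infinity>}" for n
        using A_top sets.sets_into_space[OF A(2)] by fastforce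
    qed (use f_powr w in \<open>auto simp: f_def less_imp_le\<close>)
    also have "\<dots> = ennreal (\<Sum>n. w n)"
      using power_half_series w by (intro suminf_ennreal2) (auto simp: w_def less_imp_le sums_iff)
    also have "(\<Sum>n. w n) = 1"
      using power_half_series by (simp add: w_def sums_iff)
    finally have "finite_modular f = 1" by simp
    moreover have "top_modular f = 0"
    proof (rule top_modular_eq_0[OF f])
      fix x assume "p x = \<infinity>"
      then have "x \<notin> (\<Union>n. A n)" using A_top by fastforce
      then show "f x = 0" by (simp add: f_def)
    qed
    ultimately show "modular M p f \<le> 1" by (simp add: modular_eq)
    fix l :: real assume l: "1 < l"
    obtain m where m: "4 < l ^ m" using real_arch_pow[OF l] by blast
    have "4 < l ^ n" if "m \<le> n" for n
      using m power_increasing[OF that less_imp_le[OF l]] by (rule less_le_trans)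
    then have "eventually (\<lambda>n. 4 < l ^ n) sequentially"
      by (auto simp: eventually_sequentially)
    then show "eventually (\<lambda>n. 1 < modular M p (\<lambda>x. l * (f x * indicator {x \<in> space M. ix x = n} x))) sequentially"
      using eventually_ge_at_top[of 1]
    proof eventually_elim
      case (elim n)
      have "2 ^ Suc n \<le> (4 :: real) ^ n"
      proof -
        have "(2 :: real) ^ Suc n \<le> 2 ^ (2 * n)" using elim(2) by (intro power_increasing) auto
        then show ?thesis by (simp add: power_mult)
      qed
      also have "\<dots> < (l ^ n) ^ n" using elim by (intro power_strict_mono) auto
      finally have "1 < l ^ (n * n) * w n"
        by (simp add: w_def power_mult divide_simps)
      then have "ennreal 1 < ennreal (l ^ (n * n) * w n)" by (intro ennreal_lessI) auto
      then have "1 < ennreal (l ^ (n * n) * w n)" by simp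
      also have "\<dots> = ennreal (l ^ (n * n) * w n / measure M (A n)) * ennreal (measure M (A n))"
        using A_pos[of n] w[of n] l by (simp flip: ennreal_mult)
      also have "ennreal (measure M (A n)) = emeasure M (A n)"
        using A(5)[of n] by (intro emeasure_eq_ennreal_measure[symmetric]) auto
      also have "ennreal (l ^ (n * n) * w n / measure M (A n)) * emeasure M (A n)
          = (\<integral>\<^sup>+ x. ennreal (l ^ (n * n) * w n / measure M (A n)) * indicator (A n) x \<partial>M)"
        by (simp add: nn_integral_cmult_indicator)
      also have "\<dots> \<le> finite_modular (\<lambda>x. l * (f x * indicator {x \<in> space M. ix x = n} x))"
        unfolding finite_modular_def
      proof (intro nn_integral_mono)
        fix x assume x: "x \<in> space M"
        show "ennreal (l ^ (n * n) * w n / measure M (A n)) * indicator (A n) x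
          \<le> ennreal (\<bar>l * (f x * indicator {x \<in> space M. ix x = n} x)\<bar> powr enn2real (p x))
            * indicator {x \<in> space M. p x < \<infinity>} x"
        proof (cases "x \<in> A n")
          case True
          have "l ^ (n * n) = l powr real (n * n)" using l by (simp only: powr_realpow)
          also have "\<dots> \<le> l powr enn2real (p x)" using l A_ge[OF True] by (intro powr_mono) auto
          finally have "l ^ (n * n) * (w n / measure M (A n)) \<le> l powr enn2real (p x) * (w n / measure M (A n))"
            using w[of n] by (intro mult_right_mono) auto
          also have "\<dots> = \<bar>l * f x\<bar> powr enn2real (p x)"
            using l f_powr[OF True] by (simp add: abs_mult powr_mult)
          finally show ?thesis
            using True x ix_eq[OF True] A_top[OF True] by (simp add: ennreal_leI)
        qed simp
      qed
      also have "\<dots> \<le> modular M p (\<lambda>x. l * (f x * indicator {x \<in> space M. ix x = n} x))"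
        by (simp add: modular_eq)
      finally show ?case .
    qed
  qed
qed

end

section \<open>No asymptotically isometric copy in the remaining case\<close>

context variable_exponent
begin

lemma vsum_lessThan_AE_class:
  assumes f [measurable]: "\<And>n. f n \<in> borel_measurable M"
  shows "vsum_lessThan (var_Lebesgue M p) (\<lambda>n. vscale (var_Lebesgue M p) (t n) (AE_class M (f n))) N
    = AE_class M (\<lambda>x. \<Sum>k<N. t k * f k x)"
proof (induction N)
  case 0
  show ?case by (simp add: var_Lebesgue_def)
next
  case (Suc N)
  show ?case
    unfolding vsum_lessThan.simps Suc by (simp add: AE_class_scale AE_class_add)
qed

lemma var_Lebesgue_fun_sum:
  fixes N :: nat
  assumes "\<And>n. f n \<in> var_Lebesgue_fun M p"
  shows "(\<lambda>x. \<Sum>k<N. t k * f k x) \<in> var_Lebesgue_fun M p"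
proof (induction N)
  case 0
  show ?case by (simp add: var_Lebesgue_fun_zero)
next
  case (Suc N)
  show ?case
    using var_Lebesgue_fun_add[OF Suc var_Lebesgue_fun_scale[OF assms[of N], of "t N"]] by simp
qed

text \<open>For finitely supported coefficients the partial sums are eventually constant, so the limit class and the partial sum are at distance \<open>0\<close> and have the same norm.\<close>

lemma asymptotic_copy_functions:
  assumes "contains_asymptotically_isometric_copy_ell1 (var_Lebesgue M p)"
  obtains f \<epsilon> where "\<And>n. f n \<in> var_Lebesgue_fun M p" "\<And>n. \<epsilon> n < 1" "\<epsilon> \<longlonglongrightarrow> 0"
    "\<And>t N. (\<Sum>k<N. (1 - \<epsilon> k) * \<bar>t k\<bar>) \<le> luxemburg M p (\<lambda>x. \<Sum>k<N. t k * f k x)"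
    "\<And>t N. luxemburg M p (\<lambda>x. \<Sum>k<N. t k * f k x) \<le> (\<Sum>k<N. \<bar>t k\<bar>)"
proof -
  let ?X = "var_Lebesgue M p"
  obtain z \<epsilon> where z: "\<And>n. z n \<in> vecs ?X" and \<epsilon>: "\<And>n. 0 < \<epsilon> n \<and> \<epsilon> n < 1" "\<epsilon> \<longlonglongrightarrow> 0"
    and copy: "\<And>t. t \<in> vecs ell1 \<Longrightarrow> \<exists>s. vsums ?X (\<lambda>n. vscale ?X (t n) (z n)) s \<and>
            (\<Sum>n. (1 - \<epsilon> n) * \<bar>t n\<bar>) \<le> vnorm ?X s \<and> vnorm ?X s \<le> (\<Sum>n. \<bar>t n\<bar>)"
    using assms unfolding contains_asymptotically_isometric_copy_ell1_def by blast
  have "\<exists>f. f \<in> var_Lebesgue_fun M p \<and> z n = AE_class M f" for n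
    using z[of n] by (auto simp: var_Lebesgue_def)
  then obtain f where f: "\<And>n. f n \<in> var_Lebesgue_fun M p" and z_eq: "\<And>n. z n = AE_class M (f n)"
    by metis
  have [measurable]: "f n \<in> borel_measurable M" for n using f by (rule var_Lebesgue_fun_borel)
  have both: "(\<Sum>k<N. (1 - \<epsilon> k) * \<bar>t k\<bar>) \<le> luxemburg M p (\<lambda>x. \<Sum>k<N. t k * f k x) \<and>
      luxemburg M p (\<lambda>x. \<Sum>k<N. t k * f k x) \<le> (\<Sum>k<N. \<bar>t k\<bar>)" for t and N :: nat
  proof -
    define t' where "t' k = (if k < N then t k else 0)" for k
    define F where "F x = (\<Sum>k<N. t k * f k x)" for x
    have F: "F \<in> var_Lebesgue_fun M p" unfolding F_def by (rule var_Lebesgue_fun_sum[OF f])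
    note [measurable] = F[THEN var_Lebesgue_fun_borel]
    have "t' \<in> vecs ell1" by (simp add: t'_def summable_abs_truncation)
    from copy[OF this] obtain s where s: "vsums ?X (\<lambda>n. vscale ?X (t' n) (z n)) s"
      "(\<Sum>n. (1 - \<epsilon> n) * \<bar>t' n\<bar>) \<le> vnorm ?X s" "vnorm ?X s \<le> (\<Sum>n. \<bar>t' n\<bar>)" by blast
    from s(1) have "s \<in> vecs ?X" by (simp add: vsums_def)
    then obtain h where h: "h \<in> var_Lebesgue_fun M p" and s_eq: "s = AE_class M h"
      by (auto simp: var_Lebesgue_def)
    note [measurable] = h[THEN var_Lebesgue_fun_borel]
    have "(\<Sum>k<K. t' k * f k x) = F x" if "N \<le> K" for K x
      unfolding F_def using that by (intro sum.mono_neutral_cong_right) (auto simp: t'_def)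
    then have "vnorm ?X (vadd ?X (vsum_lessThan ?X (\<lambda>n. vscale ?X (t' n) (z n)) K) (vscale ?X (- 1) s))
        = luxemburg M p (\<lambda>x. F x + - 1 * h x)" if "N \<le> K" for K
      using that unfolding z_eq s_eq
      by (subst vsum_lessThan_AE_class) (simp_all add: AE_class_scale AE_class_add AE_class_norm)
    then have "eventually (\<lambda>K. vnorm ?X (vadd ?X (vsum_lessThan ?X (\<lambda>n. vscale ?X (t' n) (z n)) K) (vscale ?X (- 1) s))
        = luxemburg M p (\<lambda>x. F x + - 1 * h x)) sequentially"
      by (auto simp: eventually_sequentially)
    with s(1) have "(\<lambda>K :: nat. luxemburg M p (\<lambda>x. F x + - 1 * h x)) \<longlonglongrightarrow> 0"
      unfolding vsums_def by (auto elim: Lim_transform_eventually)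
    then have zero: "luxemburg M p (\<lambda>x. F x + - 1 * h x) = 0"
      by (simp add: LIMSEQ_const_iff)
    have diff: "(\<lambda>x. F x + - 1 * h x) \<in> var_Lebesgue_fun M p"
      by (intro var_Lebesgue_fun_add var_Lebesgue_fun_scale F h)
    have zero': "luxemburg M p (\<lambda>x. - (F x + - 1 * h x)) = 0"
      using zero unfolding luxemburg_minus .
    have "luxemburg M p F \<le> luxemburg M p h"
      using luxemburg_triangle[OF h diff] zero by simp
    moreover have "luxemburg M p h \<le> luxemburg M p F"
      using luxemburg_triangle[OF F var_Lebesgue_fun_scale[OF diff, of "- 1"]] zero' by simp
    moreover have "vnorm ?X s = luxemburg M p h"
      unfolding s_eq by (simp add: AE_class_norm)
    moreover have "(\<Sum>n. (1 - \<epsilon> n) * \<bar>t' n\<bar>) = (\<Sum>k<N. (1 - \<epsilon> k) * \<bar>t k\<bar>)"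
      by (subst suminf_finite[of "{..<N}"]) (auto simp: t'_def)
    moreover have "(\<Sum>n. \<bar>t' n\<bar>) = (\<Sum>k<N. \<bar>t k\<bar>)"
      by (subst suminf_finite[of "{..<N}"]) (auto simp: t'_def)
    ultimately show ?thesis using s(2,3) by (simp add: F_def[abs_def])
  qed
  show thesis
    by (rule that[of f \<epsilon>]) (use f \<epsilon> both in blast)+
qed

lemma sum_three_terms:
  fixes a :: "nat \<Rightarrow> real"
  assumes "i < j" "j < n"
  shows "(\<Sum>k<Suc n. (if k = i then \<alpha> else if k = j then \<beta> else if k = n then \<gamma> else 0) * a k)
    = \<alpha> * a i + \<beta> * a j + \<gamma> * a n"
proof -
  have "(if k = i then \<alpha> else if k = j then \<beta> else if k = n then \<gamma> else 0) * a k
      = (if k = i then \<alpha> * a i else 0) + (if k = j then \<beta> * a j else 0) + (if k = n then \<gamma> * a n else 0)" for k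
    using assms by auto
  then show ?thesis using assms by (simp only: sum.distrib) simp
qed

lemma intermediate_modular_mono:
  assumes "\<And>x. \<bar>g x\<bar> \<le> \<bar>h x\<bar>"
  shows "intermediate_modular \<tau> g \<le> intermediate_modular \<tau> h"
  unfolding intermediate_modular_def
  using assms by (intro nn_integral_mono mult_right_mono ennreal_leI mult_left_mono powr_mono2) auto

text \<open>The numbers are chosen such that each of the three perturbation terms is at most \<open>\<tau> / 256\<close>, and
  together they do not use up the gap \<open>\<tau> / 64\<close> left by \<open>g\<close>.\<close>

lemma modular_perturbation_less:
  fixes \<tau> P :: real
  assumes gy [measurable]: "g \<in> borel_measurable M" "y \<in> borel_measurable M"
    and P: "AE x in M. p x < \<infinity> \<longrightarrow> enn2real (p x) \<le> P"
    and \<tau>: "0 < \<tau>" "\<tau> \<le> 1" "256 * ((1 + P\<^sup>2 * exp P) * \<tau>) \<le> 1"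
    and g_le: "modular M p g \<le> ennreal (1 - \<tau> / 64)"
    and end_le: "modular M p (\<lambda>x. y x * indicator endpoint_set x) \<le> ennreal (1 / 256)"
    and mid_le: "intermediate_modular \<tau> y \<le> ennreal (\<tau> * (1 / (256 * (1 + P\<^sup>2 * exp P))))"
  shows "modular M p (\<lambda>x. g x + \<tau> * y x) + modular M p (\<lambda>x. g x - \<tau> * y x) < 2"
proof -
  define C where "C = 1 + P\<^sup>2 * exp P"
  have C: "1 \<le> C" by (simp add: C_def)
  have "modular M p (\<lambda>x. g x + \<tau> * y x) + modular M p (\<lambda>x. g x - \<tau> * y x)
      \<le> 2 * (modular M p g + ennreal \<tau> * modular M p (\<lambda>x. y x * indicator endpoint_set x)
        + ennreal C * (intermediate_modular \<tau> y + ennreal (\<tau>\<^sup>2) * modular M p g))"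
    unfolding C_def by (rule modular_smooth_le[OF gy P \<tau>(1,2)])
  also have "\<dots> \<le> 2 * (ennreal (1 - \<tau> / 64) + ennreal \<tau> * ennreal (1 / 256)
        + ennreal C * (ennreal (\<tau> * (1 / (256 * C))) + ennreal (\<tau>\<^sup>2) * ennreal (1 - \<tau> / 64)))"
    using g_le end_le mid_le unfolding C_def by (intro mult_left_mono add_mono) auto
  also have "\<dots> = ennreal (2 * ((1 - \<tau> / 64) + \<tau> * (1 / 256) + C * (\<tau> * (1 / (256 * C)) + \<tau>\<^sup>2 * (1 - \<tau> / 64))))"
  proof -
    have lift: "2 * (ennreal a + ennreal \<tau> * ennreal b + ennreal C * (ennreal u + ennreal v * ennreal a))
        = ennreal (2 * (a + \<tau> * b + C * (u + v * a)))"
      if "0 \<le> a" "0 \<le> b" "0 \<le> u" "0 \<le> v" for a b u v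
      using that \<tau> C by (simp add: ennreal_mult)
    show ?thesis using \<tau> C by (intro lift) auto
  qed
  also have "\<dots> < ennreal 2"
  proof (rule ennreal_lessI)
    have "C * (\<tau> * (1 / (256 * C))) = \<tau> / 256" using C by simp
    moreover have "C * \<tau> * \<tau> * (1 - \<tau> / 64) \<le> (1 / 256) * \<tau> * 1"
      using \<tau> C by (intro mult_mono) (auto simp: C_def)
    ultimately show "2 * ((1 - \<tau> / 64) + \<tau> * (1 / 256) + C * (\<tau> * (1 / (256 * C)) + \<tau>\<^sup>2 * (1 - \<tau> / 64))) < 2"
      using \<tau>(1) by (simp only: distrib_left power2_eq_square mult.assoc) argo
  qed simp
  finally show ?thesis by simp
qed

text \<open>Let \<open>c = 1 + \<tau> / 16\<close>. The lower \<open>\<ell>\<^sub>1\<close> estimate forces the modulars of \<open>(f n + \<tau> y) / c\<close> and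
  \<open>(f n - \<tau> y) / c\<close> above \<open>1\<close>. Since \<open>f n\<close> has norm at most \<open>1\<close>, division by \<open>c\<close> brings its modular down to
  \<open>1 - \<tau> / 64\<close>, and by \<open>modular_perturbation_less\<close> the perturbation cannot make up for this loss.
  The direction \<open>y\<close> is fixed before \<open>\<tau>\<close>, and \<open>\<tau>\<close> before \<open>n\<close>; this works because the estimates for the
  perturbation are uniform in \<open>n\<close>.\<close>

lemma no_asymptotically_isometric_copy:
  assumes copy: "contains_asymptotically_isometric_copy_ell1 (var_Lebesgue M p)"
    and P: "AE x in M. p x < \<infinity> \<longrightarrow> enn2real (p x) \<le> P"
    and pre1: "precompact_on {x \<in> space M. p x = 1}" and pretop: "precompact_on {x \<in> space M. p x = \<infinity>}"
  shows False
proof -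
  obtain f \<epsilon> where f: "\<And>n. f n \<in> var_Lebesgue_fun M p" and \<epsilon>: "\<And>n. \<epsilon> n < 1" "\<epsilon> \<longlonglongrightarrow> 0"
    and lower: "\<And>t N. (\<Sum>k<N. (1 - \<epsilon> k) * \<bar>t k\<bar>) \<le> luxemburg M p (\<lambda>x. \<Sum>k<N. t k * f k x)"
    and upper: "\<And>t N. luxemburg M p (\<lambda>x. \<Sum>k<N. t k * f k x) \<le> (\<Sum>k<N. \<bar>t k\<bar>)"
    by (rule asymptotic_copy_functions[OF copy]) (rule that)
  have [measurable]: "f n \<in> borel_measurable M" for n using f by (rule var_Lebesgue_fun_borel)
  have combination:
    "(1 - \<epsilon> i) * \<bar>\<alpha>\<bar> + (1 - \<epsilon> j) * \<bar>\<beta>\<bar> + (1 - \<epsilon> n) * \<bar>\<gamma>\<bar> \<le> luxemburg M p (\<lambda>x. \<alpha> * f i x + \<beta> * f j x + \<gamma> * f n x)"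
    "luxemburg M p (\<lambda>x. \<alpha> * f i x + \<beta> * f j x + \<gamma> * f n x) \<le> \<bar>\<alpha>\<bar> + \<bar>\<beta>\<bar> + \<bar>\<gamma>\<bar>"
    if ijn: "i < j" "j < n" for i j n and \<alpha> \<beta> \<gamma>
  proof -
    let ?u = "\<lambda>k. if k = i then \<alpha> else if k = j then \<beta> else if k = n then \<gamma> else 0"
    have abs_u: "\<bar>?u k\<bar> = (if k = i then \<bar>\<alpha>\<bar> else if k = j then \<bar>\<beta>\<bar> else if k = n then \<bar>\<gamma>\<bar> else 0)" for k
      by simp
    have "(\<Sum>k<Suc n. (1 - \<epsilon> k) * \<bar>?u k\<bar>) = (1 - \<epsilon> i) * \<bar>\<alpha>\<bar> + (1 - \<epsilon> j) * \<bar>\<beta>\<bar> + (1 - \<epsilon> n) * \<bar>\<gamma>\<bar>"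
      unfolding abs_u using sum_three_terms[OF ijn, of "\<bar>\<alpha>\<bar>" "\<bar>\<beta>\<bar>" "\<bar>\<gamma>\<bar>" "\<lambda>k. 1 - \<epsilon> k"]
      by (simp only: mult.commute)
    with lower[where t = ?u and N = "Suc n"] show
      "(1 - \<epsilon> i) * \<bar>\<alpha>\<bar> + (1 - \<epsilon> j) * \<bar>\<beta>\<bar> + (1 - \<epsilon> n) * \<bar>\<gamma>\<bar> \<le> luxemburg M p (\<lambda>x. \<alpha> * f i x + \<beta> * f j x + \<gamma> * f n x)"
      by (simp only: sum_three_terms[OF ijn])
    have "(\<Sum>k<Suc n. \<bar>?u k\<bar>) = \<bar>\<alpha>\<bar> + \<bar>\<beta>\<bar> + \<bar>\<gamma>\<bar>"
      unfolding abs_u using sum_three_terms[OF ijn, of "\<bar>\<alpha>\<bar>" "\<bar>\<beta>\<bar>" "\<bar>\<gamma>\<bar>" "\<lambda>k. 1"]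
      by (simp only: mult_1_right)
    with upper[where t = ?u and N = "Suc n"] show
      "luxemburg M p (\<lambda>x. \<alpha> * f i x + \<beta> * f j x + \<gamma> * f n x) \<le> \<bar>\<alpha>\<bar> + \<bar>\<beta>\<bar> + \<bar>\<gamma>\<bar>"
      by (simp only: sum_three_terms[OF ijn])
  qed
  have f_norm: "luxemburg M p (f n) \<le> 1" for n
  proof -
    let ?u = "\<lambda>k. if k = n then 1 else 0 :: real"
    have "(\<Sum>k<Suc n. ?u k * f k x) = f n x" for x
      by (simp add: if_distrib[of "\<lambda>c. c * _"] cong: if_cong)
    moreover have "(\<Sum>k<Suc n. \<bar>?u k\<bar>) = 1" by (simp add: if_distrib cong: if_cong)
    ultimately show ?thesis using upper[where t = ?u and N = "Suc n"] by (simp only: eta_contract_eq)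
  qed
  have "endpoint_set = {x \<in> space M. p x = 1} \<union> {x \<in> space M. p x = \<infinity>}"
    by (auto simp: endpoint_set_def)
  moreover have "{x \<in> space M. p x = 1} \<inter> {x \<in> space M. p x = \<infinity>} = {}" by auto
  ultimately have pre: "precompact_on endpoint_set"
    using precompact_on_Un[OF _ _ _ _ pre1 pretop] by auto
  \<comment> \<open>Halving puts the functions strictly inside the unit ball, so that their modulars are at most \<open>1\<close>.\<close>
  define h where "h n = (\<lambda>x. f n x / 2)" for n
  have h [measurable]: "h n \<in> borel_measurable M" for n unfolding h_def by measurable
  have "modular M p (\<lambda>x. h n x * indicator endpoint_set x) \<le> 1" for n
  proof -
    have "modular M p (\<lambda>x. h n x * indicator endpoint_set x) \<le> modular M p (h n)"
      by (intro modular_mono) (auto split: split_indicator)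
    also have "\<dots> \<le> 1"
      unfolding h_def using f_norm[of n] by (intro modular_le_1_of_luxemburg_less f) simp
    finally show ?thesis .
  qed
  then obtain r :: "nat \<Rightarrow> nat" where r: "strict_mono r"
    and Cauchy: "modular_Cauchy_on endpoint_set (\<lambda>n. h (r n))"
    by (rule precompact_onD[OF pre h]) (rule that)
  have pos: "(0 :: real) < 1 / 256" by simp
  obtain m1 where m1: "\<And>i j. m1 \<le> i \<Longrightarrow> m1 \<le> j \<Longrightarrow>
      modular M p (\<lambda>x. (h (r i) x - h (r j) x) * indicator endpoint_set x) \<le> ennreal (1 / 256)"
    by (rule modular_Cauchy_onD[OF Cauchy pos]) (rule that)
  have "eventually (\<lambda>n. \<epsilon> n < 1 / 2) sequentially"
    using \<epsilon>(2) by (intro order_tendstoD) auto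
  then obtain m2 where m2: "\<And>n. m2 \<le> n \<Longrightarrow> \<epsilon> n < 1 / 2" by (auto simp: eventually_sequentially)
  define i where "i = r (max m1 m2)"
  define j where "j = r (Suc (max m1 m2))"
  have ij: "i < j" unfolding i_def j_def using r by (simp add: strict_mono_less)
  have "max m1 m2 \<le> i" unfolding i_def using r by (rule strict_mono_imp_increasing)
  then have \<epsilon>ij: "\<epsilon> i < 1 / 2" "\<epsilon> j < 1 / 2" using ij m2[of i] m2[of j] by auto
  define y where "y = (\<lambda>x. (f i x - f j x) / 4)"
  have y [measurable]: "y \<in> borel_measurable M" unfolding y_def by measurable
  have y_end: "modular M p (\<lambda>x. y x * indicator endpoint_set x) \<le> ennreal (1 / 256)"
  proof -
    have "modular M p (\<lambda>x. y x * indicator endpoint_set x)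
        \<le> modular M p (\<lambda>x. (h i x - h j x) * indicator endpoint_set x)"
      by (intro modular_mono) (auto simp: y_def h_def abs_if split: split_indicator)
    also have "\<dots> \<le> ennreal (1 / 256)" unfolding i_def j_def by (rule m1) auto
    finally show ?thesis .
  qed
  have y_fun: "y \<in> var_Lebesgue_fun M p"
    using var_Lebesgue_fun_scale[OF var_Lebesgue_fun_add[OF f var_Lebesgue_fun_scale[OF f, of "- 1"]], of "1 / 4" i j]
    by (simp add: y_def)
  have "y = (\<lambda>x. 1 / 4 * f i x + - 1 / 4 * f j x + 0 * f (Suc j) x)"
    by (auto simp: y_def)
  then have "luxemburg M p y < 1"
    using combination(2)[OF ij lessI, of "1 / 4" "- 1 / 4" 0] by simp
  from modular_le_1_of_luxemburg_less[OF y_fun this] have "modular M p y < \<infinity>"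
    by (simp add: le_less_trans[OF _ ennreal_one_less_top])
  define C where "C = 1 + P\<^sup>2 * exp P"
  have C: "1 \<le> C" by (simp add: C_def)
  have "eventually (\<lambda>N. intermediate_modular (1 / real (Suc N)) y
      \<le> ennreal (1 / real (Suc N)) * ennreal (1 / (256 * C))) sequentially"
    using C by (intro intermediate_modular_small y \<open>modular M p y < \<infinity>\<close>) auto
  moreover have "eventually (\<lambda>N. 1 / real (Suc N) < 1 / (256 * C)) sequentially"
    using C LIMSEQ_Suc[OF lim_1_over_n] by (intro order_tendstoD) auto
  ultimately have "eventually (\<lambda>N. intermediate_modular (1 / real (Suc N)) y
      \<le> ennreal (1 / real (Suc N)) * ennreal (1 / (256 * C)) \<and> 1 / real (Suc N) < 1 / (256 * C)) sequentially"
    by (rule eventually_conj)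
  then obtain N where N: "intermediate_modular (1 / real (Suc N)) y
      \<le> ennreal (1 / real (Suc N)) * ennreal (1 / (256 * C))" "1 / real (Suc N) < 1 / (256 * C)"
    by (auto dest: eventually_happens)
  define \<tau> where "\<tau> = 1 / real (Suc N)"
  have \<tau>: "0 < \<tau>" "\<tau> \<le> 1" "256 * (C * \<tau>) \<le> 1"
    using N(2) C by (simp_all add: \<tau>_def field_simps)
  have mid: "intermediate_modular \<tau> y \<le> ennreal (\<tau> * (1 / (256 * C)))"
    using N(1) C \<tau>(1) unfolding \<tau>_def[symmetric] by (subst ennreal_mult) auto
  have "eventually (\<lambda>n. \<epsilon> n < \<tau> / 8) sequentially"
    using \<epsilon>(2) \<tau>(1) by (intro order_tendstoD) auto
  from eventually_conj[OF this eventually_gt_at_top[of j]]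
  obtain n where n: "\<epsilon> n < \<tau> / 8" "j < n" by (auto dest: eventually_happens)
  define c where "c = 1 + \<tau> / 16"
  have c: "1 < c" "c \<le> 2" using \<tau> by (auto simp: c_def)
  have large: "1 < modular M p (\<lambda>x. (f n x + s * \<tau> * y x) / c)" if s: "\<bar>s\<bar> = 1" for s
  proof (rule ccontr)
    assume "\<not> 1 < modular M p (\<lambda>x. (f n x + s * \<tau> * y x) / c)"
    then have "luxemburg M p (\<lambda>x. f n x + s * \<tau> * y x) \<le> c"
      using c by (intro luxemburg_le) auto
    also have "(\<lambda>x. f n x + s * \<tau> * y x) = (\<lambda>x. (s * \<tau> / 4) * f i x + (- s * \<tau> / 4) * f j x + 1 * f n x)"
      by (auto simp: y_def algebra_simps diff_divide_distrib)
    finally have "(1 - \<epsilon> i) * \<bar>s * \<tau> / 4\<bar> + (1 - \<epsilon> j) * \<bar>- s * \<tau> / 4\<bar> + (1 - \<epsilon> n) * \<bar>1\<bar> \<le> c"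
      using combination(1)[OF ij n(2), of "s * \<tau> / 4" "- s * \<tau> / 4" 1] by linarith
    then have "(1 - \<epsilon> i) * (\<tau> / 4) + (1 - \<epsilon> j) * (\<tau> / 4) + (1 - \<epsilon> n) \<le> c"
      using s \<tau>(1) by (simp add: abs_mult)
    moreover have "1 / 2 * (\<tau> / 4) \<le> (1 - \<epsilon> i) * (\<tau> / 4)" "1 / 2 * (\<tau> / 4) \<le> (1 - \<epsilon> j) * (\<tau> / 4)"
      using \<epsilon>ij \<tau>(1) by (auto intro!: mult_right_mono)
    ultimately show False using n(1) \<tau>(1) unfolding c_def by linarith
  qed
  let ?g = "\<lambda>x. f n x / c"
  let ?y = "\<lambda>x. y x / c"
  have y_le: "\<bar>?y x\<bar> \<le> \<bar>y x\<bar>" for x using c mult_left_mono[of 1 c "\<bar>y x\<bar>"] by (simp add: pos_divide_le_eq)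
  have "modular M p (\<lambda>x. ?g x + \<tau> * ?y x) + modular M p (\<lambda>x. ?g x - \<tau> * ?y x) < 2"
  proof (rule modular_perturbation_less[OF _ _ P \<tau>(1,2) \<tau>(3)[unfolded C_def]])
    \<comment> \<open>A scale strictly between the norm of \<open>f n\<close> and \<open>c\<close>, where the modular is known to be at most \<open>1\<close>.\<close>
    define d where "d = 1 + \<tau> / 32"
    have d: "0 < d" "d \<le> c" using \<tau>(1) by (auto simp: d_def c_def)
    have "modular M p ?g \<le> ennreal (d / c) * modular M p (\<lambda>x. f n x / d)"
      using d by (intro modular_divide_le) auto
    also have "\<dots> \<le> ennreal (d / c) * 1"
      using f_norm[of n] \<tau>(1) by (intro mult_left_mono modular_le_1_of_luxemburg_less f) (auto simp: d_def)
    also have "d / c \<le> 1 - \<tau> / 64"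
    proof -
      have "\<tau> / 64 * c \<le> \<tau> / 64 * 2" using c \<tau>(1) by (intro mult_left_mono) auto
      moreover have "(1 - \<tau> / 64) * c = c - \<tau> / 64 * c" by (simp add: left_diff_distrib)
      moreover have "c = d + \<tau> / 32" by (simp add: d_def c_def)
      ultimately have "d \<le> (1 - \<tau> / 64) * c" by linarith
      then show ?thesis using c by (simp add: pos_divide_le_eq)
    qed
    finally show "modular M p ?g \<le> ennreal (1 - \<tau> / 64)" by (simp add: ennreal_leI)
    have "modular M p (\<lambda>x. ?y x * indicator endpoint_set x) \<le> modular M p (\<lambda>x. y x * indicator endpoint_set x)"
      using y_le by (intro modular_mono) (auto split: split_indicator)
    with y_end show "modular M p (\<lambda>x. ?y x * indicator endpoint_set x) \<le> ennreal (1 / 256)"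
      by (rule order_trans[rotated])
    show "intermediate_modular \<tau> ?y \<le> ennreal (\<tau> * (1 / (256 * (1 + P\<^sup>2 * exp P))))"
      using order_trans[OF intermediate_modular_mono[OF y_le] mid] by (simp only: C_def)
  qed measurable
  moreover have "(\<lambda>x. ?g x + \<tau> * ?y x) = (\<lambda>x. (f n x + 1 * \<tau> * y x) / c)"
    "(\<lambda>x. ?g x - \<tau> * ?y x) = (\<lambda>x. (f n x + - 1 * \<tau> * y x) / c)"
    by (auto simp: add_divide_distrib diff_divide_distrib)
  ultimately have small: "modular M p (\<lambda>x. (f n x + 1 * \<tau> * y x) / c) + modular M p (\<lambda>x. (f n x + - 1 * \<tau> * y x) / c) < 2"
    by (simp only:)
  have "1 + 1 \<le> modular M p (\<lambda>x. (f n x + 1 * \<tau> * y x) / c) + modular M p (\<lambda>x. (f n x + - 1 * \<tau> * y x) / c)"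
    by (intro add_mono less_imp_le large) simp_all
  from le_less_trans[OF this small] show False by simp
qed

end

section \<open>Isometric and asymptotically isometric copies\<close>

theorem theorem5p4:
  fixes M :: "'a measure" and p :: "'a \<Rightarrow> ennreal"
  assumes "sigma_finite_measure M" and "complete_measure M"
    and "p \<in> borel_measurable M" and "\<forall>x\<in>space M. 1 \<le> p x"
  shows "contains_isometric_copy_ell1 (var_Lebesgue M p) \<longleftrightarrow>
         contains_asymptotically_isometric_copy_ell1 (var_Lebesgue M p)"
proof
  interpret sigma_finite_variable_exponent M p
    using assms by (intro sigma_finite_variable_exponent.intro variable_exponent.intro) auto
  {
    assume "contains_isometric_copy_ell1 (var_Lebesgue M p)"
    then show "contains_asymptotically_isometric_copy_ell1 (var_Lebesgue M p)"
    proof (rule asymptotically_isometric_copy_of_isometric_copy[rotated])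
      fix v assume "v \<in> vecs (var_Lebesgue M p)"
      then obtain f where f: "f \<in> var_Lebesgue_fun M p" "v = AE_class M f"
        by (auto simp: var_Lebesgue_def)
      then have "vscale (var_Lebesgue M p) 0 v = AE_class M (\<lambda>x. 0)"
        by (simp add: AE_class_scale var_Lebesgue_fun_borel)
      then show "vscale (var_Lebesgue M p) 0 v = vzero (var_Lebesgue M p)"
        by (simp add: var_Lebesgue_def)
    qed
  next
    assume "contains_asymptotically_isometric_copy_ell1 (var_Lebesgue M p)"
    then have "\<not> precompact_on {x \<in> space M. p x = 1} \<or> \<not> precompact_on {x \<in> space M. p x = \<infinity>} \<or>
        (\<nexists>P. AE x in M. p x < \<infinity> \<longrightarrow> enn2real (p x) \<le> P)"
      using no_asymptotically_isometric_copy by blast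
    then show "contains_isometric_copy_ell1 (var_Lebesgue M p)"
      using isometric_copy_ell1_of_exponent_1 isometric_copy_ell1_of_top_exponent
        isometric_copy_ell1_of_unbounded_exponent by blast
  }
qed

end
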